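(* Let $\{\mathfrak{s}_k\}_{k\in\mathbb{N}}$ be a sequence of nontrivial primitive signatures and let $T$ be a Borel automorphism of a separable metric space $(X,\rho)$. Then there exist a metrically universal $T$-invariant Borel subset $\widehat X\subset X$ consisting of $T$-aperiodic points and a basic Borel filtration $\Xi=\{\xi_k\}_{k\ge0}$ on $\widehat X$ which is a basic filtration for $T|_{\widehat X}$, such that for every $k\ge1$ the partition $\xi_k/\xi_{k-1}$ is subordinate to the signature $\mathfrak{s}_k$ (i.e. every element of $\xi_k$ is the union of exactly $m$ elements of $\xi_{k-1}$ for some $m\in\mathfrak{s}_k$).
   Context: A Borel automorphism is an invertible map with $T$ and $T^{-1}$ Borel measurable. $M_{\mathrm{ap}}(X,T)$ is the set of $T$-invariant Borel probability measures on $X$ giving measure zero to the set of $T$-periodic points; a Borel set $\widehat X$ is metrically universal if $\mu(\widehat X)=1$ for all $\mu\in M_{\mathrm{ap}}(X,T)$. A signature is a finite nonempty set of positive integers; primitive means its elements are jointly coprime; trivial means it equals $\{1\}$. A partition is subordinate to a signature $\mathfrak{s}$ if all its elements are finite with cardinality in $\mathfrak{s}$. A Borel filtration of a standard Borel space $Y$ is a decreasing (each partition coarser than the previous) sequence $\{\xi_n\}_{n\ge0}$ of Borel partitions with $\xi_0$ the partition into points. It is locally finite if for each $n$ the cardinalities of the elements of $\xi_n$ are bounded by a constant depending on $n$. It is ordered if each element of the quotient partition $\xi_{n+1}/\xi_n$ (i.e. the set of $\xi_n$-elements composing a given $\xi_{n+1}$-element) carries a linear order, measurably (the set of points whose $\xi_n$-element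 has a given position in its $\xi_{n+1}$-element is Borel); these induce coherent linear orders on the elements of each $\xi_n$. A basic filtration is a locally finite ordered Borel filtration. A basic filtration is a basic filtration for a Borel automorphism $T$ of $Y$ if every element $\alpha$ of every $\xi_k$ is of the form $\{T^jx: j=0,\dots,|\alpha|-1\}$ ordered by $j$, and for every $x$ the union over $k$ of the elements $\xi_k(x)$ containing $x$ equals the $T$-orbit of $x$. *)

theory Defs
  imports "HOL-Probability.Probability" "HOL-Library.Disjoint_Sets"
begin

definition periodic_pt :: "('a \<Rightarrow> 'a) \<Rightarrow> 'a \<Rightarrow> bool" where
  "periodic_pt T x \<longleftrightarrow> (\<exists>n>0. (T ^^ n) x = x)"

definition orbit :: "('a \<Rightarrow> 'a) \<Rightarrow> 'a \<Rightarrow> 'a set" where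
  "orbit T x = {y. \<exists>n. y = (T ^^ n) x \<or> x = (T ^^ n) y}"

definition borel_automorphism :: "('a::topological_space \<Rightarrow> 'a) \<Rightarrow> bool" where
  "borel_automorphism T \<longleftrightarrow> bij T \<and> T \<in> borel_measurable borel \<and> inv T \<in> borel_measurable borel"

definition M_ap :: "('a::topological_space \<Rightarrow> 'a) \<Rightarrow> 'a measure set" where
  "M_ap T = {\<mu>. sets \<mu> = sets borel \<and> prob_space \<mu>
              \<and> (\<forall>A\<in>sets borel. emeasure \<mu> (T -` A) = emeasure \<mu> A)
              \<and> (AE x in \<mu>. \<not> periodic_pt T x)}"

definition metrically_universal :: "('a::topological_space \<Rightarrow> 'a) \<Rightarrow> 'a set \<Rightarrow> bool" where
  "metrically_universal T Xh \<longleftrightarrow> Xh \<in> sets borel \<and> (\<forall>\<mu>\<in>M_ap T. emeasure \<mu> Xh = 1)"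

definition signature :: "nat set \<Rightarrow> bool" where
  "signature s \<longleftrightarrow> finite s \<and> s \<noteq> {} \<and> (\<forall>m\<in>s. m > 0)"

definition primitive_sig :: "nat set \<Rightarrow> bool" where
  "primitive_sig s \<longleftrightarrow> Gcd s = 1"

definition trivial_sig :: "nat set \<Rightarrow> bool" where
  "trivial_sig s \<longleftrightarrow> s = {1}"

definition subordinate :: "'b set set \<Rightarrow> nat set \<Rightarrow> bool" where
  "subordinate P s \<longleftrightarrow> (\<forall>\<alpha>\<in>P. finite \<alpha> \<and> card \<alpha> \<in> s)"

definition cell :: "'a set set \<Rightarrow> 'a \<Rightarrow> 'a set" where
  "cell P x = (THE \<alpha>. \<alpha> \<in> P \<and> x \<in> \<alpha>)"

definition borel_partition :: "'a::topological_space set \<Rightarrow> 'a set set \<Rightarrow> bool" where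
  "borel_partition Y P \<longleftrightarrow> partition_on Y P \<and> (\<forall>\<alpha>\<in>P. \<alpha> \<in> sets borel)
     \<and> {(x, y). \<exists>\<alpha>\<in>P. x \<in> \<alpha> \<and> y \<in> \<alpha>} \<in> sets (borel \<Otimes>\<^sub>M borel)"

definition borel_filtration :: "'a::topological_space set \<Rightarrow> (nat \<Rightarrow> 'a set set) \<Rightarrow> bool" where
  "borel_filtration Y \<xi> \<longleftrightarrow> (\<forall>n. borel_partition Y (\<xi> n))
     \<and> \<xi> 0 = {{x} | x. x \<in> Y}
     \<and> (\<forall>n. \<forall>\<alpha>\<in>\<xi> n. \<exists>\<beta>\<in>\<xi> (Suc n). \<alpha> \<subseteq> \<beta>)"

definition locally_finite_filtration :: "(nat \<Rightarrow> 'a set set) \<Rightarrow> bool" where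
  "locally_finite_filtration \<xi> \<longleftrightarrow> (\<forall>n. \<exists>C::nat. \<forall>\<alpha>\<in>\<xi> n. finite \<alpha> \<and> card \<alpha> \<le> C)"

definition quot_elem :: "(nat \<Rightarrow> 'a set set) \<Rightarrow> nat \<Rightarrow> 'a set \<Rightarrow> 'a set set" where
  "quot_elem \<xi> n \<beta> = {\<alpha> \<in> \<xi> n. \<alpha> \<subseteq> \<beta>}"

definition quot_partition :: "(nat \<Rightarrow> 'a set set) \<Rightarrow> nat \<Rightarrow> 'a set set set" where
  "quot_partition \<xi> n = {quot_elem \<xi> n \<beta> | \<beta>. \<beta> \<in> \<xi> (Suc n)}"

(* Ordered filtration: pos n \<alpha> is the (0-based) position of \<alpha> \<in> \<xi> n inside the
   linearly ordered element of \<xi>_{n+1}/\<xi>_n containing it; measurability of positions. *)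
definition ordered_filtration ::
  "'a::topological_space set \<Rightarrow> (nat \<Rightarrow> 'a set set) \<Rightarrow> (nat \<Rightarrow> 'a set \<Rightarrow> nat) \<Rightarrow> bool" where
  "ordered_filtration Y \<xi> pos \<longleftrightarrow> borel_filtration Y \<xi>
     \<and> (\<forall>n. \<forall>\<beta>\<in>\<xi> (Suc n). bij_betw (pos n) (quot_elem \<xi> n \<beta>) {..<card (quot_elem \<xi> n \<beta>)})
     \<and> (\<forall>n i. {x \<in> Y. pos n (cell (\<xi> n) x) = i} \<in> sets borel)"

definition basic_filtration ::
  "'a::topological_space set \<Rightarrow> (nat \<Rightarrow> 'a set set) \<Rightarrow> (nat \<Rightarrow> 'a set \<Rightarrow> nat) \<Rightarrow> bool" where
  "basic_filtration Y \<xi> pos \<longleftrightarrow> ordered_filtration Y \<xi> pos \<and> locally_finite_filtration \<xi>"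

(* position of the point x in the induced (lexicographic, coherent) linear order on \<xi>_k(x) *)
fun frank :: "(nat \<Rightarrow> 'a set set) \<Rightarrow> (nat \<Rightarrow> 'a set \<Rightarrow> nat) \<Rightarrow> nat \<Rightarrow> 'a \<Rightarrow> nat" where
  "frank \<xi> pos 0 x = 0"
| "frank \<xi> pos (Suc k) x =
     (\<Sum>\<alpha>\<in>{\<alpha> \<in> quot_elem \<xi> k (cell (\<xi> (Suc k)) x). pos k \<alpha> < pos k (cell (\<xi> k) x)}. card \<alpha>)
     + frank \<xi> pos k x"

definition basic_filtration_for ::
  "('a::topological_space \<Rightarrow> 'a) \<Rightarrow> 'a set \<Rightarrow> (nat \<Rightarrow> 'a set set) \<Rightarrow> (nat \<Rightarrow> 'a set \<Rightarrow> nat) \<Rightarrow> bool" where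
  "basic_filtration_for T Y \<xi> pos \<longleftrightarrow> basic_filtration Y \<xi> pos
     \<and> (\<forall>k. \<forall>\<alpha>\<in>\<xi> k. \<exists>x. \<alpha> = {(T ^^ j) x | j. j < card \<alpha>}
                            \<and> (\<forall>j < card \<alpha>. frank \<xi> pos k ((T ^^ j) x) = j))
     \<and> (\<forall>x\<in>Y. (\<Union>k. cell (\<xi> k) x) = orbit T x)"

end

theory Submission
  imports Defs
begin

text \<open>Every Borel automorphism \<open>S\<close> of a separable metric space admits, for each \<open>N\<close>, a Borel set of markers
  meeting every aperiodic orbit with gaps in \<open>[N, 2N)\<close>. A primitive signature represents all large numbers as
  sums, so each gap can be cut into pieces with lengths in the signature; if the signature is nontrivial,
  pieces of length \<open>1\<close> can be confined to an initial segment of the gap whose length \<open>c\<close> does not depend on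
  \<open>N\<close>. The cut points \<open>C\<close> then satisfy \<open>2 \<mu>(C) \<le> \<mu>(aper S) + c/N\<close> for all invariant probabilities \<open>\<mu>\<close>.

  Induce \<open>S\<close> on \<open>C\<close> and extend it by the identity: the result is again a Borel automorphism, now with
  aperiodic part exactly \<open>C\<close>, so the construction iterates, giving automorphisms \<open>R k\<close> with decreasing aperiodic
  parts \<open>B k\<close> whose intersection is null for every invariant \<open>\<mu>\<close>. Off the orbits of this intersection the
  towers of \<open>T\<close> over the sets \<open>B k\<close> exhaust the orbits, and they form the required filtration.\<close>

section \<open>Cutting long intervals\<close>

text \<open>The numerical semigroup generated by \<open>s\<close>, built one summand at a time so
  that a sum can be turned into a cutting of an interval by induction.\<close>

inductive_set sums_of :: "nat set \<Rightarrow> nat set" for s where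
  zero: "0 \<in> sums_of s"
| step: "L \<in> sums_of s \<Longrightarrow> m \<in> s \<Longrightarrow> L + m \<in> sums_of s"

lemma sums_of_add: "b \<in> sums_of s \<Longrightarrow> a \<in> sums_of s \<Longrightarrow> a + b \<in> sums_of s"
  by (induction b rule: sums_of.induct)
    (auto simp: add.assoc[symmetric] intro: sums_of.intros)

lemma sums_of_mult: "a \<in> sums_of s \<Longrightarrow> n * a \<in> sums_of s"
  by (induction n) (auto intro: sums_of.zero sums_of_add)

lemma sums_of_mono: "s \<subseteq> t \<Longrightarrow> sums_of s \<subseteq> sums_of t"
proof
  fix x assume "s \<subseteq> t" "x \<in> sums_of s"
  show "x \<in> sums_of t" using \<open>x \<in> sums_of s\<close>
    by induction (use \<open>s \<subseteq> t\<close> in \<open>auto intro: sums_of.intros\<close>)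
qed

text \<open>A subtraction-free Bezout identity. From
  \<open>m * x = Gcd s * y + gcd m (Gcd s)\<close>, adding \<open>y * v\<close> to both sides leaves
  \<open>y * v + x * m\<close> and \<open>y * (v + Gcd s)\<close>, two sums whose difference is the
  new gcd.\<close>

lemma sums_of_diff_Gcd:
  assumes "finite s" "\<forall>m\<in>s. m > 0"
  shows "\<exists>u\<in>sums_of s. u + Gcd s \<in> sums_of s"
  using assms
proof (induction s rule: finite_induct)
  case empty
  show ?case by (auto intro: sums_of.zero)
next
  case (insert m s)
  then obtain v where v: "v \<in> sums_of s" "v + Gcd s \<in> sums_of s" by auto
  have sub: "sums_of s \<subseteq> sums_of (insert m s)" by (rule sums_of_mono) auto
  have "m \<noteq> 0" using insert.prems by auto
  then obtain x y where xy: "m * x = Gcd s * y + gcd m (Gcd s)" using bezout_nat[of m "Gcd s"] by blast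
  have "0 + m \<in> sums_of (insert m s)" by (rule sums_of.step[OF sums_of.zero]) simp
  then have m: "m \<in> sums_of (insert m s)" by simp
  have "y * v + x * m = y * (v + Gcd s) + Gcd (insert m s)"
    using xy by (simp add: algebra_simps)
  moreover have "y * v + x * m \<in> sums_of (insert m s)"
    using v sub m by (intro sums_of_add sums_of_mult) auto
  moreover have "y * (v + Gcd s) \<in> sums_of (insert m s)"
    using v sub by (intro sums_of_mult) auto
  ultimately show ?case by metis
qed

text \<open>Two consecutive sums \<open>u\<close> and \<open>u + 1\<close> suffice: in
  \<open>L = q * u + r\<close> with \<open>r < u\<close> and \<open>u \<le> q\<close>, exchanging
  \<open>r\<close> copies of \<open>u\<close> for \<open>u + 1\<close> absorbs the
  remainder.\<close>

lemma eventually_sums_of: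
  assumes "finite s" "\<forall>m\<in>s. m > 0" "Gcd s = 1"
  shows "\<exists>F. \<forall>L\<ge>F. L \<in> sums_of s"
proof -
  obtain u where u: "u \<in> sums_of s" "u + 1 \<in> sums_of s"
    using sums_of_diff_Gcd[OF assms(1,2)] assms(3) by auto
  have "L \<in> sums_of s" if L: "L \<ge> u * u" for L
  proof (cases "u = 0")
    case True
    \<comment> \<open>For \<open>u = 0\<close> the element \<open>u + 1\<close> is \<open>1\<close>,
      whose multiples are all numbers.\<close>
    then show ?thesis using sums_of_mult[OF u(2), of L] by simp
  next
    case False
    define q r where "q = L div u" and "r = L mod u"
    have L': "L = q * u + r" by (simp add: q_def r_def)
    have "r < u" using False by (simp add: r_def)
    moreover have "u \<le> q" using False div_le_mono[OF L, of u] by (simp add: q_def)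
    ultimately obtain d where "q = r + d" by (metis le_Suc_ex less_imp_le order_trans)
    then have "L = d * u + r * (u + 1)" using L' by (simp add: algebra_simps)
    then show ?thesis using u by (metis sums_of_add sums_of_mult)
  qed
  then show ?thesis by blast
qed

text \<open>Steps of length \<open>1\<close> are confined to the initial segment \<open>{..<R}\<close>, so that they are rare in long
  intervals even if \<open>1 \<in> s\<close>.\<close>

definition cuts :: "nat set \<Rightarrow> nat \<Rightarrow> nat \<Rightarrow> nat set \<Rightarrow> bool" where
  "cuts s R L P \<longleftrightarrow> P \<subseteq> {..<L} \<and> (L > 0 \<longrightarrow> 0 \<in> P)
     \<and> (\<forall>p\<in>P. \<exists>m\<in>s. p + m \<in> insert L P \<and> (\<forall>i. 0 < i \<and> i < m \<longrightarrow> p + i \<notin> P))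
     \<and> (\<forall>p\<in>P. Suc p \<in> insert L P \<longrightarrow> p < R)"

lemma cuts_zero: "cuts s R L P \<Longrightarrow> 0 < L \<Longrightarrow> 0 \<in> P"
  unfolding cuts_def by (elim conjE) (rule mp)

lemma cuts_less: "cuts s R L P \<Longrightarrow> p \<in> P \<Longrightarrow> p < L"
  unfolding cuts_def by (elim conjE) (drule subsetD; simp)

lemma cuts_step:
  "cuts s R L P \<Longrightarrow> p \<in> P \<Longrightarrow> \<exists>m\<in>s. p + m \<in> insert L P \<and> (\<forall>i. 0 < i \<and> i < m \<longrightarrow> p + i \<notin> P)"
  unfolding cuts_def by (elim conjE) (rule bspec)

lemma cuts_unit_step: "cuts s R L P \<Longrightarrow> p \<in> P \<Longrightarrow> Suc p \<in> insert L P \<Longrightarrow> p < R"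
  unfolding cuts_def by (elim conjE) (drule bspec, assumption, rule mp)

text \<open>The old endpoint \<open>L\<close> becomes a cut point. Old steps already ended at or
  before \<open>L\<close>, and only the last piece can be a new unit step.\<close>

lemma cuts_extend:
  assumes c: "cuts s R L P" and m: "m \<in> s" "m > 0" and one: "m = 1 \<Longrightarrow> L < R"
  shows "cuts s R (L + m) (insert L P)"
proof -
  note P = cuts_less[OF c]
  have "\<exists>m'\<in>s. p + m' \<in> insert (L + m) (insert L P) \<and> (\<forall>i. 0 < i \<and> i < m' \<longrightarrow> p + i \<notin> insert L P)"
    if p: "p \<in> insert L P" for p
  proof (cases "p = L")
    case True
    have "L + i \<notin> insert L P" if "0 < i" for i using P[of "L + i"] that by auto
    then show ?thesis using True m by (intro bexI[of _ m]) auto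
  next
    case False
    then have "p \<in> P" using p by simp
    from cuts_step[OF c this] obtain m' where
      m': "m' \<in> s" "p + m' \<in> insert L P" "\<forall>i. 0 < i \<and> i < m' \<longrightarrow> p + i \<notin> P"
      by (elim bexE conjE)
    have "p + m' \<le> L" using m'(2) P[of "p + m'"] by auto
    then show ?thesis using m' by (intro bexI[of _ m']) auto
  qed
  note steps = this
  have ones: "p < R" if p: "p \<in> insert L P" and q: "Suc p \<in> insert (L + m) (insert L P)" for p
  proof (cases "p = L")
    case True
    then have "Suc L = L + m" using q P[of "Suc L"] by auto
    then show ?thesis using one True by simp
  next
    case False
    then have "p \<in> P" using p by simp
    then have "Suc p \<in> insert L P" using q P[of p] m by auto
    then show ?thesis using cuts_unit_step[OF c \<open>p \<in> P\<close>] by blast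
  qed
  have "insert L P \<subseteq> {..<L + m}" using P m by (auto dest: P)
  moreover have "0 \<in> insert L P" using cuts_zero[OF c] by auto
  ultimately show ?thesis using steps ones by (simp only: cuts_def) simp
qed

text \<open>With \<open>L \<le> R\<close> the condition on unit steps is vacuous, so the summands
  may be laid down in any order.\<close>

lemma cuts_sums_of:
  assumes "L \<in> sums_of s" "\<forall>m\<in>s. m > 0"
  shows "L \<le> R \<Longrightarrow> \<exists>P. cuts s R L P"
  using assms
proof (induction L rule: sums_of.induct)
  case zero
  have "cuts s R 0 {}" by (simp add: cuts_def)
  then show ?case by blast
next
  case (step L m)
  then obtain P where "cuts s R L P" by auto
  then have "cuts s R (L + m) (insert L P)" using step by (intro cuts_extend) auto
  then show ?case by blast
qed

text \<open>Intervals of length up to \<open>F + M\<close> are cut arbitrarily. Longer ones are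
  obtained by appending pieces of a fixed length \<open>M \<ge> 2\<close>, which creates no unit
  step beyond the bound \<open>F + M\<close>.\<close>

lemma eventually_cuts:
  assumes "signature s" "primitive_sig s" "\<not> trivial_sig s"
  shows "\<exists>F R. \<forall>L\<ge>F. \<exists>P. cuts s R L P"
proof -
  have s: "finite s" "\<forall>m\<in>s. m > 0" "Gcd s = 1" "s \<noteq> {}"
    using assms by (auto simp: signature_def primitive_sig_def)
  obtain M where M: "M \<in> s" "M \<ge> 2"
  proof (rule ccontr)
    assume "\<not> thesis"
    then have "\<forall>m\<in>s. m = 1" using that s(2) by (metis One_nat_def Suc_1 Suc_leI le_antisym not_less_eq_eq)
    then have "s = {1}" using s(4) by auto
    then show False using assms by (simp add: trivial_sig_def)
  qed
  obtain F where F: "\<forall>L\<ge>F. L \<in> sums_of s" using eventually_sums_of[OF s(1,2,3)] by blast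
  have "\<exists>P. cuts s (F + M) L P" if "L \<ge> F" for L
    using that
  proof (induction L rule: less_induct)
    case (less L)
    show ?case
    proof (cases "L \<le> F + M")
      case True
      then show ?thesis using F less.prems s(2) by (intro cuts_sums_of) auto
    next
      case False
      then have "F \<le> L - M" "L - M < L" using M by auto
      then obtain P where "cuts s (F + M) (L - M) P" using less.IH by blast
      then have "cuts s (F + M) (L - M + M) (insert (L - M) P)"
        using M by (intro cuts_extend) auto
      then show ?thesis using False by auto
    qed
  qed
  then show ?thesis by blast
qed

section \<open>Powers of Borel automorphisms\<close>

definition aper :: "('a \<Rightarrow> 'a) \<Rightarrow> 'a set" where
  "aper S = {x. \<not> periodic_pt S x}"

lemma aper_iff: "x \<in> aper S \<longleftrightarrow> (\<forall>n>0. (S ^^ n) x \<noteq> x)"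
  unfolding aper_def periodic_pt_def by blast

lemma funpow_plus: "(S ^^ (m + n)) x = (S ^^ m) ((S ^^ n) x)"
  by (simp add: funpow_add)

lemma funpow_inj:
  fixes S :: "'a \<Rightarrow> 'a"
  shows "bij S \<Longrightarrow> (S ^^ n) x = (S ^^ n) y \<longleftrightarrow> x = y"
  using inj_fn[of S n] by (meson bij_is_inj injD)

lemma funpow_inv:
  fixes S :: "'a \<Rightarrow> 'a"
  shows "bij S \<Longrightarrow> (S ^^ n) ((inv S ^^ n) x) = x" "bij S \<Longrightarrow> (inv S ^^ n) ((S ^^ n) x) = x"
  by (simp_all only: fn_o_inv_fn_is_id[unfolded comp_def, THEN fun_cong] inv_fn_o_fn_is_id[unfolded comp_def, THEN fun_cong])

lemma funpow_inv_diff: "bij S \<Longrightarrow> m \<le> n \<Longrightarrow> (S ^^ m) ((inv S ^^ n) x) = (inv S ^^ (n - m)) x"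
  using funpow_plus[of m "n - m" "inv S" x] funpow_inv(1)[of S m] by simp

lemma funpow_cancel:
  assumes "bij S" "(S ^^ a) x = (S ^^ b) y" "a \<le> b"
  shows "x = (S ^^ (b - a)) y"
proof -
  have "(S ^^ a) x = (S ^^ a) ((S ^^ (b - a)) y)"
    using assms(2,3) funpow_plus[of a "b - a" S y] by simp
  then show ?thesis using funpow_inj[OF assms(1)] by blast
qed

lemma aper_funpow:
  assumes "bij S"
  shows "(S ^^ n) x \<in> aper S \<longleftrightarrow> x \<in> aper S"
proof -
  have "(S ^^ m) ((S ^^ n) x) = (S ^^ n) x \<longleftrightarrow> (S ^^ m) x = x" for m
    using funpow_plus[of m n S x] funpow_plus[of n m S x] funpow_inj[OF assms, of n]
    by (simp add: add.commute)
  then show ?thesis by (simp add: aper_iff)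
qed

lemma aper_inv_funpow:
  assumes "bij S"
  shows "(inv S ^^ n) x \<in> aper S \<longleftrightarrow> x \<in> aper S"
  using aper_funpow[OF assms, of n "(inv S ^^ n) x"] funpow_inv(1)[OF assms] by simp

lemma aper_inj:
  assumes "bij S" "x \<in> aper S" "(S ^^ m) x = (S ^^ n) x"
  shows "m = n"
proof -
  have "m = n" if "(S ^^ m) x = (S ^^ n) x" "m \<le> n" for m n
    using funpow_cancel[OF assms(1) that] assms(2) that(2) unfolding aper_iff
    by (metis diff_is_0_eq le_antisym not_gr_zero)
  then show ?thesis using assms(3) by (metis nat_le_linear)
qed

lemma borel_automorphism_bij: "borel_automorphism S \<Longrightarrow> bij S"
  by (simp add: borel_automorphism_def)

lemma borel_measurable_funpow:
  fixes S :: "'a::topological_space \<Rightarrow> 'a"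
  shows "S \<in> borel_measurable borel \<Longrightarrow> S ^^ n \<in> borel_measurable borel"
proof (induction n)
  case (Suc n)
  then show ?case using measurable_comp[of "S ^^ n" borel borel S borel] by simp
qed (simp add: id_def)

lemma automorphism_measurable:
  assumes "borel_automorphism S"
  shows "S ^^ n \<in> borel_measurable borel" "inv S ^^ n \<in> borel_measurable borel"
  using assms by (simp_all add: borel_automorphism_def borel_measurable_funpow)

lemma funpow_vimage_borel:
  assumes "borel_automorphism S" "E \<in> sets borel"
  shows "(S ^^ n) -` E \<in> sets borel" "(inv S ^^ n) -` E \<in> sets borel"
  using automorphism_measurable[OF assms(1), of n] assms(2) by (auto dest: measurable_sets_borel)

lemma funpow_image_vimage:
  fixes S :: "'a \<Rightarrow> 'a"
  shows "bij S \<Longrightarrow> (S ^^ n) ` E = (inv S ^^ n) -` E"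
  by (metis bij_fn bij_imp_bij_inv bij_vimage_eq_inv_image inv_fn inv_inv_eq)

lemma funpow_image_borel:
  assumes "borel_automorphism S" "E \<in> sets borel"
  shows "(S ^^ n) ` E \<in> sets borel"
  using funpow_vimage_borel(2)[OF assms, of n] funpow_image_vimage[of S n E] assms(1)
  by (simp add: borel_automorphism_bij)

section \<open>Invariant probabilities and piecewise powers\<close>

text \<open>In contrast to \<open>M_ap\<close>, periodic points may have positive measure: induced
  maps fix everything off their section.\<close>

definition invariant_prob :: "('a::topological_space \<Rightarrow> 'a) \<Rightarrow> 'a measure \<Rightarrow> bool" where
  "invariant_prob S \<mu> \<longleftrightarrow> sets \<mu> = sets borel \<and> prob_space \<mu> \<and> (\<forall>E\<in>sets borel. emeasure \<mu> (S -` E) = emeasure \<mu> E)"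

lemma emeasure_funpow_vimage:
  assumes "invariant_prob S \<mu>" "borel_automorphism S" "E \<in> sets borel"
  shows "emeasure \<mu> ((S ^^ n) -` E) = emeasure \<mu> E"
proof (induction n)
  case (Suc n)
  have "(S ^^ Suc n) -` E = S -` ((S ^^ n) -` E)" by (simp only: funpow_Suc_right vimage_comp)
  also have "emeasure \<mu> \<dots> = emeasure \<mu> ((S ^^ n) -` E)"
    using assms(1) funpow_vimage_borel(1)[OF assms(2,3), of n] by (simp only: invariant_prob_def)
  finally show ?case using Suc by (simp only:)
qed simp

lemma emeasure_funpow_image:
  assumes "invariant_prob S \<mu>" "borel_automorphism S" "E \<in> sets borel"
  shows "emeasure \<mu> ((S ^^ n) ` E) = emeasure \<mu> E"
proof -
  have "(S ^^ n) -` ((S ^^ n) ` E) = E"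
    using assms(2) by (intro inj_vimage_image_eq bij_is_inj bij_fn borel_automorphism_bij)
  then show ?thesis
    using emeasure_funpow_vimage[OF assms(1,2) funpow_image_borel[OF assms(2,3), of n], of n] by simp
qed

text \<open>The level sets of \<open>m\<close> form a countable Borel partition, and on each piece
  \<open>S'\<close> is a single power of \<open>S\<close>. Images and preimages are therefore Borel
  piece by piece, and the measures add up because the images of the pieces are disjoint.\<close>

lemma piecewise_power_automorphism:
  fixes m :: "'a::topological_space \<Rightarrow> nat"
  assumes S: "borel_automorphism S" and bij: "bij S'" and m: "m \<in> measurable borel (count_space UNIV)"
    and S': "\<And>x. S' x = (S ^^ m x) x"
  shows "borel_automorphism S'" "invariant_prob S \<mu> \<Longrightarrow> invariant_prob S' \<mu>"
proof -
  define X where "X n = m -` {n}" for n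
  have X: "X n \<in> sets borel" for n using m unfolding X_def by (auto intro: measurable_sets_borel)
  have disj: "disjoint_family X" and cover: "(\<Union>n. X n) = UNIV"
    by (auto simp: X_def disjoint_family_on_def)
  have vim: "S' -` E \<inter> X n = (S ^^ n) -` E \<inter> X n" for E n by (auto simp: X_def S')
  have img: "S' ` (E \<inter> X n) = (S ^^ n) ` (E \<inter> X n)" for E n by (auto simp: X_def S')
  have vimU: "S' -` E = (\<Union>n. S' -` E \<inter> X n)" for E using cover by blast
  have imgU: "S' ` E = (\<Union>n. S' ` (E \<inter> X n))" for E using cover by blast
  have Evim: "S' -` E \<inter> X n \<in> sets borel" if "E \<in> sets borel" for E n
    unfolding vim using that X funpow_vimage_borel(1)[OF S] by blast
  have Eimg: "S' ` (E \<inter> X n) \<in> sets borel" if "E \<in> sets borel" for E n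
    unfolding img using that X funpow_image_borel[OF S] by blast
  have "S' -` E \<in> sets borel" if "E \<in> sets borel" for E
    by (subst vimU) (use Evim that in blast)
  moreover have "inv S' -` E \<in> sets borel" if "E \<in> sets borel" for E
  proof -
    \<comment> \<open>Measurability of the inverse amounts to images being Borel.\<close>
    have "inv S' -` E = S' ` E" using bij_vimage_eq_inv_image[OF bij_imp_bij_inv[OF bij], of E] inv_inv_eq[OF bij]
      by simp
    also have "\<dots> \<in> sets borel" by (subst imgU) (use Eimg that in blast)
    finally show ?thesis .
  qed
  ultimately show aut: "borel_automorphism S'"
    using bij by (simp add: borel_automorphism_def measurable_def)
  assume inv: "invariant_prob S \<mu>"
  then have sets: "sets \<mu> = sets borel" by (simp add: invariant_prob_def)
  have "emeasure \<mu> (S' -` E) = emeasure \<mu> E" if E: "E \<in> sets borel" for E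
  proof -
    \<comment> \<open>\<open>Y n\<close> is the part of \<open>E\<close> reached from the piece
      \<open>X n\<close>; there \<open>S'\<close> agrees with one power of \<open>S\<close>, whose
      images keep the measure.\<close>
    define Y where "Y n = E \<inter> S' ` X n" for n
    have YE: "Y n = S' ` (S' -` E \<inter> X n)" for n unfolding Y_def by auto
    have Y: "Y n \<in> sets borel" for n unfolding Y_def using E Eimg[of UNIV n] by auto
    have dY: "disjoint_family Y"
      using disj image_Int[OF bij_is_inj[OF bij]] unfolding disjoint_family_on_def Y_def by (metis Int_assoc Int_left_commute image_empty inf_bot_right)
    have UY: "(\<Union>n. Y n) = E"
      unfolding Y_def using cover bij_is_surj[OF bij] by (metis Int_UN_distrib Int_UNIV_right image_UN)
    have "emeasure \<mu> (S' -` E \<inter> X n) = emeasure \<mu> (Y n)" for n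
    proof -
      have "Y n = (S ^^ n) ` (S' -` E \<inter> X n)" unfolding YE img ..
      then show ?thesis using emeasure_funpow_image[OF inv S Evim[OF E]] by simp
    qed
    moreover have "(\<Sum>n. emeasure \<mu> (S' -` E \<inter> X n)) = emeasure \<mu> (S' -` E)"
      by (subst vimU, intro suminf_emeasure)
        (use Evim[OF E] sets disj in \<open>auto simp: disjoint_family_on_def, blast\<close>)
    moreover have "(\<Sum>n. emeasure \<mu> (Y n)) = emeasure \<mu> E"
      using suminf_emeasure[of Y \<mu>] dY Y UY sets by auto
    ultimately show ?thesis by simp
  qed
  then show "invariant_prob S' \<mu>" using inv by (simp add: invariant_prob_def)
qed

section \<open>Induced automorphisms\<close>

text \<open>The first return time for points of \<open>C\<close>, the first positive hitting time
  elsewhere. If the forward orbit never meets \<open>C\<close> after time \<open>0\<close>, the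
  value is unspecified.\<close>

definition ret :: "('a \<Rightarrow> 'a) \<Rightarrow> 'a set \<Rightarrow> 'a \<Rightarrow> nat" where
  "ret S C x = (LEAST m. 0 < m \<and> (S ^^ m) x \<in> C)"

lemma retI:
  assumes "0 < m" "(S ^^ m) x \<in> C"
  shows "0 < ret S C x" "(S ^^ ret S C x) x \<in> C" "ret S C x \<le> m"
  using LeastI[of "\<lambda>m. 0 < m \<and> (S ^^ m) x \<in> C" m] Least_le[of "\<lambda>m. 0 < m \<and> (S ^^ m) x \<in> C" m] assms
  unfolding ret_def by simp_all

lemma not_before_ret: "0 < i \<Longrightarrow> i < ret S C x \<Longrightarrow> (S ^^ i) x \<notin> C"
  using not_less_Least[of i "\<lambda>m. 0 < m \<and> (S ^^ m) x \<in> C"] unfolding ret_def by simp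

lemma ret_eqI:
  assumes "0 < m" "(S ^^ m) x \<in> C" "\<And>i. 0 < i \<Longrightarrow> i < m \<Longrightarrow> (S ^^ i) x \<notin> C"
  shows "ret S C x = m"
  using retI[OF assms(1,2)] assms(3) by (meson le_neq_implies_less)

lemma measurable_ret:
  assumes S: "borel_automorphism S" and C: "C \<in> sets borel"
  shows "ret S C \<in> measurable borel (count_space UNIV)"
proof -
  have "Measurable.pred borel (\<lambda>x. (S ^^ m) x \<in> C)" for m
    using funpow_vimage_borel(1)[OF S C, of m] by (simp add: pred_def vimage_def)
  then have "Measurable.pred borel (\<lambda>x. 0 < m \<and> (S ^^ m) x \<in> C)" for m
    by (cases "0 < m") simp_all
  then show ?thesis unfolding ret_def[abs_def] by (rule measurable_Least)
qed

text \<open>Forward visits make return times meaningful; backward visits place every aperiodic point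
  in a tower over \<open>C\<close>, which is what surjectivity of the induced map needs.\<close>

definition recurrent_section :: "('a \<Rightarrow> 'a) \<Rightarrow> 'a set \<Rightarrow> bool" where
  "recurrent_section S C \<longleftrightarrow> C \<subseteq> aper S \<and> (\<forall>x\<in>aper S. (\<exists>m>0. (S ^^ m) x \<in> C) \<and> (\<exists>m>0. (inv S ^^ m) x \<in> C))"

lemma recurrent_section_ret:
  assumes "recurrent_section S C" "x \<in> aper S"
  shows "0 < ret S C x" "(S ^^ ret S C x) x \<in> C"
proof -
  obtain m where "0 < m" "(S ^^ m) x \<in> C" using assms unfolding recurrent_section_def by meson
  then show "0 < ret S C x" "(S ^^ ret S C x) x \<in> C" by (rule retI)+
qed

text \<open>Cancelling the smaller power would place one base point strictly between another and its
  first return. Hence the levels of the Kakutani towers over \<open>C\<close> are disjoint.\<close>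

lemma tower_unique:
  assumes "bij S" "x \<in> C" "y \<in> C" "a < ret S C x" "b < ret S C y" "(S ^^ a) x = (S ^^ b) y"
  shows "x = y \<and> a = b"
proof -
  have *: "x = y \<and> a = b"
    if h: "x \<in> C" "y \<in> C" "b < ret S C y" "(S ^^ a) x = (S ^^ b) y" "a \<le> b" for x y a b
  proof -
    have x: "x = (S ^^ (b - a)) y" using funpow_cancel[OF assms(1) h(4,5)] .
    have "b - a < ret S C y" using h(3) by simp
    then have "\<not> 0 < b - a" using not_before_ret[of "b - a" S C y] x h(1) by metis
    then have "b - a = 0" by simp
    then show ?thesis using x h(5) by simp
  qed
  show ?thesis
  proof (cases "a \<le> b")
    case True
    then show ?thesis using * assms by blast
  next
    case False
    then have "b \<le> a" by simp
    then show ?thesis using *[OF assms(3,2,4) assms(6)[symmetric]] by blast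
  qed
qed

text \<open>The base point is the most recent visit to \<open>C\<close>, time \<open>0\<close>
  included. If its first return came at or before \<open>x\<close>, that return would be a more
  recent visit.\<close>

lemma tower_exists:
  assumes S: "bij S" and C: "recurrent_section S C" and x: "x \<in> aper S"
  obtains y j where "y \<in> C" "j < ret S C y" "x = (S ^^ j) y"
proof -
  define j where "j = (LEAST j. (inv S ^^ j) x \<in> C)"
  define y where "y = (inv S ^^ j) x"
  have ex: "\<exists>j. (inv S ^^ j) x \<in> C" using C x unfolding recurrent_section_def by blast
  have y: "y \<in> C" unfolding y_def j_def by (rule LeastI_ex[OF ex])
  have jx: "x = (S ^^ j) y" unfolding y_def using funpow_inv(1)[OF S] by simp
  have yA: "y \<in> aper S" using y C unfolding recurrent_section_def by blast
  have "j < ret S C y"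
  proof (rule ccontr)
    assume "\<not> j < ret S C y"
    then have le: "ret S C y \<le> j" by simp
    then have "(inv S ^^ (j - ret S C y)) x = (S ^^ ret S C y) y"
      using funpow_inv_diff[OF S le, of x] by (simp only: y_def)
    then have "(inv S ^^ (j - ret S C y)) x \<in> C" using recurrent_section_ret(2)[OF C yA] by simp
    then have "j \<le> j - ret S C y" unfolding j_def by (rule Least_le)
    then show False using recurrent_section_ret(1)[OF C yA] le by linarith
  qed
  then show ?thesis using that y jx by blast
qed

text \<open>Off \<open>C\<close> the induced map is the identity, so that it is a bijection of the whole space with aperiodic
  part \<open>C\<close>.\<close>

definition induced :: "('a \<Rightarrow> 'a) \<Rightarrow> 'a set \<Rightarrow> 'a \<Rightarrow> 'a" where
  "induced S C x = (S ^^ (if x \<in> C then ret S C x else 0)) x"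

lemma induced_simps:
  "x \<in> C \<Longrightarrow> induced S C x = (S ^^ ret S C x) x"
  "x \<notin> C \<Longrightarrow> induced S C x = x"
  by (simp_all add: induced_def)

text \<open>Injectivity: if two points of \<open>C\<close> had the same image and different return
  times, the one with the longer time would meet the other before its first return. Surjectivity:
  the predecessor of a point of \<open>C\<close> is the top of a tower.\<close>

lemma bij_induced:
  assumes S: "bij S" and C: "recurrent_section S C"
  shows "bij (induced S C)"
proof (rule bijI)
  have CA: "C \<subseteq> aper S" using C unfolding recurrent_section_def by blast
  have into: "induced S C x \<in> C" if "x \<in> C" for x
    using recurrent_section_ret(2)[OF C, of x] CA that induced_simps(1) by (metis subsetD)
  show "inj (induced S C)"
  proof (rule injI)
    fix x y assume eq: "induced S C x = induced S C y"
    have *: "x = y" if h: "x \<in> C" "y \<in> C" "induced S C x = induced S C y" "ret S C x \<le> ret S C y" for x y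
    proof -
      have x: "x = (S ^^ (ret S C y - ret S C x)) y"
        using funpow_cancel[OF S _ h(4), of x y] h induced_simps(1) by metis
      have "0 < ret S C x" using recurrent_section_ret(1)[OF C] CA h(1) by blast
      then have "\<not> 0 < ret S C y - ret S C x" using not_before_ret[of "ret S C y - ret S C x" S C y] x h(1)
        by (metis diff_less less_le_trans h(4))
      then show ?thesis using x by simp
    qed
    consider "x \<in> C" "y \<in> C" | "x \<notin> C" "y \<notin> C" | "x \<in> C" "y \<notin> C" | "x \<notin> C" "y \<in> C" by blast
    then show "x = y"
    proof cases
      case 1
      then show ?thesis using *[OF 1 eq] *[OF 1(2,1) eq[symmetric]] by (metis nat_le_linear)
    qed (use eq into induced_simps(2) in metis)+
  qed
  have "\<exists>x. induced S C x = z" for z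
  proof (cases "z \<in> C")
    case True
    \<comment> \<open>The tower is taken through the predecessor, since \<open>z\<close> itself is a
      base point and would only lead to the tower above it.\<close>
    have "inv S z \<in> aper S" using CA True aper_inv_funpow[OF S, of 1 z] by auto
    from tower_exists[OF S C this] obtain y j where y: "y \<in> C" "j < ret S C y" "inv S z = (S ^^ j) y" .
    have z: "z = (S ^^ Suc j) y" using y(3) S by (metis bij_inv_eq_iff comp_apply funpow.simps(2))
    have "Suc j = ret S C y"
    proof (rule ccontr)
      assume "Suc j \<noteq> ret S C y"
      then have "Suc j < ret S C y" using y(2) by simp
      then have "(S ^^ Suc j) y \<notin> C" by (intro not_before_ret) auto
      then show False using True z by simp
    qed
    then show ?thesis using z y(1) induced_simps(1) by metis
  next
    case False
    then show ?thesis using induced_simps(2) by metis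
  qed
  then show "surj (induced S C)" by (metis surjI)
qed

text \<open>On \<open>C\<close> the \<open>n\<close>-th power of the induced map acts at each point
  as a power of \<open>S\<close> with exponent at least \<open>n\<close>, so for positive
  \<open>n\<close> it moves that point; off \<open>C\<close> all points are fixed.\<close>

lemma aper_induced:
  assumes S: "bij S" and C: "recurrent_section S C"
  shows "aper (induced S C) = C"
proof (rule set_eqI)
  fix x
  have CA: "C \<subseteq> aper S" using C unfolding recurrent_section_def by blast
  show "x \<in> aper (induced S C) \<longleftrightarrow> x \<in> C"
  proof (cases "x \<in> C")
    case True
    have "(induced S C ^^ n) x \<in> C \<and> (\<exists>k\<ge>n. (induced S C ^^ n) x = (S ^^ k) x)" for n
    proof (induction n)
      case 0
      have "(S ^^ 0) x = x" by simp
      then show ?case using True by (metis funpow_0 le0)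
    next
      case (Suc n)
      define y where "y = (induced S C ^^ n) x"
      from Suc obtain k where k: "y \<in> C" "k \<ge> n" "y = (S ^^ k) x" unfolding y_def by blast
      have "(induced S C ^^ Suc n) x = (S ^^ ret S C y) y" using k(1) by (simp add: y_def induced_simps(1))
      also have "\<dots> = (S ^^ (ret S C y + k)) x" using k(3) funpow_plus by metis
      finally have "(induced S C ^^ Suc n) x = (S ^^ (ret S C y + k)) x" .
      moreover have "0 < ret S C y" "(S ^^ ret S C y) y \<in> C" using recurrent_section_ret[OF C] CA k(1) by blast+
      moreover have "ret S C y + k \<ge> Suc n" using calculation(2) k(2) by linarith
      moreover have "(induced S C ^^ Suc n) x \<in> C"
        using calculation(3) \<open>(induced S C ^^ Suc n) x = (S ^^ ret S C y) y\<close> by (simp only:)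
      ultimately show ?case by blast
    qed
    note powers = this
    have "(induced S C ^^ n) x \<noteq> x" if n: "n > 0" for n
    proof -
      obtain k where "k \<ge> n" "(induced S C ^^ n) x = (S ^^ k) x" using powers[of n] by blast
      moreover have "x \<in> aper S" using CA True by blast
      ultimately show ?thesis using n unfolding aper_iff by simp
    qed
    then show ?thesis using True unfolding aper_iff by blast
  next
    case False
    then have "(induced S C ^^ 1) x = x" by (simp add: induced_simps(2))
    then have "x \<notin> aper (induced S C)" unfolding aper_iff by (metis zero_less_one)
    then show ?thesis using False by blast
  qed
qed

lemma induced_automorphism:
  assumes S: "borel_automorphism S" and C: "recurrent_section S C" "C \<in> sets borel"
  shows "borel_automorphism (induced S C)" "invariant_prob S \<mu> \<Longrightarrow> invariant_prob (induced S C) \<mu>"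
proof -
  note m = measurable_If_set[OF measurable_ret[OF S C(2)], of "\<lambda>_. 0" C]
  have "(\<lambda>x. if x \<in> C then ret S C x else 0) \<in> measurable borel (count_space UNIV)"
    using C(2) by (intro m) auto
  note piecewise_power_automorphism[OF S bij_induced[OF borel_automorphism_bij[OF S] C(1)] this induced_def]
  then show "borel_automorphism (induced S C)" "invariant_prob S \<mu> \<Longrightarrow> invariant_prob (induced S C) \<mu>"
    by blast+
qed

section \<open>Markers and sections\<close>

text \<open>A sequence of sets rather than a type class, because separability is a hypothesis on the
  given metric space.\<close>

definition countable_basis :: "(nat \<Rightarrow> 'a::topological_space set) \<Rightarrow> bool" where
  "countable_basis U \<longleftrightarrow> (\<forall>i. open (U i)) \<and> (\<forall>V x. open V \<longrightarrow> x \<in> V \<longrightarrow> (\<exists>i. x \<in> U i \<and> U i \<subseteq> V))"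

lemma countable_basis_exists:
  assumes "countable D" "closure D = (UNIV :: 'a::metric_space set)"
  shows "\<exists>U :: nat \<Rightarrow> 'a set. countable_basis U"
proof -
  define \<B> where "\<B> = (\<lambda>(d, n). ball d (inverse (real (Suc n)))) ` (D \<times> (UNIV :: nat set))"
  have "D \<noteq> {}" using assms(2) by auto
  then have "\<B> \<noteq> {}" by (simp add: \<B>_def)
  moreover have "countable \<B>" using assms(1) by (simp add: \<B>_def)
  ultimately obtain U :: "nat \<Rightarrow> 'a set" where U: "range U = \<B>" by (metis range_from_nat_into)
  have "open (U i)" for i
  proof -
    have "U i \<in> \<B>" using U by blast
    then show ?thesis by (auto simp: \<B>_def)
  qed
  moreover have "\<exists>i. x \<in> U i \<and> U i \<subseteq> V" if V: "open V" "x \<in> V" for V x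
  proof -
    obtain e where e: "e > 0" "ball x e \<subseteq> V" using V open_contains_ball by blast
    obtain n where n: "inverse (real (Suc n)) < e / 2" using reals_Archimedean[of "e / 2"] e by auto
    have "x \<in> closure D" using assms(2) by simp
    moreover have "0 < inverse (real (Suc n))" by simp
    ultimately obtain d where d: "d \<in> D" "dist d x < inverse (real (Suc n))"
      unfolding closure_approachable by blast
    have "ball d (inverse (real (Suc n))) \<subseteq> ball x e"
    proof
      fix y assume "y \<in> ball d (inverse (real (Suc n)))"
      then have "dist d y < e / 2" using n by simp
      moreover have "dist x d < e / 2" using d(2) n by (simp add: dist_commute)
      ultimately show "y \<in> ball x e" using dist_triangle_half_r[of d x e y] by (simp add: dist_commute)
    qed
    moreover have "x \<in> ball d (inverse (real (Suc n)))" using d by simp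
    moreover have "ball d (inverse (real (Suc n))) \<in> range U" using d(1) U by (auto simp: \<B>_def)
    ultimately show ?thesis using e(2) by (metis (no_types, lifting) imageE order_trans)
  qed
  ultimately show ?thesis unfolding countable_basis_def by blast
qed

lemma countable_basis_separates:
  assumes "countable_basis (U :: nat \<Rightarrow> 'a::metric_space set)" "finite F" "x \<notin> F"
  obtains i where "x \<in> U i" "U i \<inter> F = {}"
proof -
  have "open (- F)" "x \<in> - F" using assms by (auto intro: finite_imp_closed)
  then obtain i where "x \<in> U i" "U i \<subseteq> - F" using assms(1) unfolding countable_basis_def by meson
  then show ?thesis using that[of i] by blast
qed

lemma countable_basis_borel: "countable_basis U \<Longrightarrow> U i \<in> sets borel"
  by (simp add: countable_basis_def)

text \<open>That a power of \<open>S\<close> moves a point is witnessed by a basic open set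
  containing the point and missing its image, so the condition is a countable union of Borel
  conditions.\<close>

lemma aper_borel:
  fixes S :: "'a::metric_space \<Rightarrow> 'a" and U :: "nat \<Rightarrow> 'a set"
  assumes U: "countable_basis U" and S: "borel_automorphism S"
  shows "aper S \<in> sets borel"
proof -
  have "{x. (S ^^ n) x \<noteq> x} = (\<Union>i. U i - (S ^^ n) -` U i)" for n
  proof -
    have "\<exists>i. x \<in> U i \<and> (S ^^ n) x \<notin> U i" if "(S ^^ n) x \<noteq> x" for x
      using countable_basis_separates[OF U, of "{(S ^^ n) x}" x] that by auto
    then show ?thesis by auto
  qed
  moreover have "(\<Union>i. U i - (S ^^ n) -` U i) \<in> sets borel" for n
    using countable_basis_borel[OF U] funpow_vimage_borel(1)[OF S]
    by (intro sets.countable_UN sets.Diff) auto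
  ultimately have b: "{x. (S ^^ n) x \<noteq> x} \<in> sets borel" for n by simp
  have "aper S = (\<Inter>n. {x. (S ^^ Suc n) x \<noteq> x})"
  proof (rule set_eqI)
    fix x show "x \<in> aper S \<longleftrightarrow> x \<in> (\<Inter>n. {x. (S ^^ Suc n) x \<noteq> x})"
      unfolding aper_iff INT_iff mem_Collect_eq by (metis UNIV_I gr0_conv_Suc zero_less_Suc)
  qed
  moreover have "range (\<lambda>n. {x. (S ^^ Suc n) x \<noteq> x}) \<subseteq> sets borel"
    using b by blast
  then have "(\<Inter>n. {x. (S ^^ Suc n) x \<noteq> x}) \<in> sets borel" by (rule sets.countable_INT) simp
  ultimately show ?thesis by simp
qed

section \<open>Markers with bounded gaps\<close>

text \<open>A greedy construction of a maximal set of points at least \<open>N\<close> steps apart.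
  A whole set of candidates can be treated at once because each \<open>A i\<close> will itself be
  separated.\<close>

primrec greedy_union :: "('a \<Rightarrow> 'a) \<Rightarrow> nat \<Rightarrow> (nat \<Rightarrow> 'a set) \<Rightarrow> nat \<Rightarrow> 'a set" where
  "greedy_union S N A 0 = {}"
| "greedy_union S N A (Suc i) = greedy_union S N A i \<union>
     (A i - (\<Union>j<N. (S ^^ j) -` greedy_union S N A i \<union> (inv S ^^ j) -` greedy_union S N A i))"

lemma greedy_union_mono: "i \<le> k \<Longrightarrow> greedy_union S N A i \<subseteq> greedy_union S N A k"
  by (rule lift_Suc_mono_le[of "greedy_union S N A"]) auto

lemma greedy_union_subset: "greedy_union S N A i \<subseteq> (\<Union>i. A i)"
  by (induction i) auto

lemma greedy_union_borel:
  assumes "borel_automorphism S" "\<And>i. A i \<in> sets borel"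
  shows "greedy_union S N A i \<in> sets borel"
proof (induction i)
  case (Suc i)
  then show ?case using assms(2) funpow_vimage_borel[OF assms(1) Suc]
    by (simp only: greedy_union.simps) (intro sets.Un sets.Diff sets.finite_UN; simp)
qed simp

text \<open>Two old points are separated by induction, an old and a new one by the exclusion in both
  directions of time, and two new ones by the separation of \<open>A i\<close>.\<close>

lemma greedy_union_separated:
  assumes S: "bij S" and A: "\<And>i x j. x \<in> A i \<Longrightarrow> 0 < j \<Longrightarrow> j < N \<Longrightarrow> (S ^^ j) x \<notin> A i"
  shows "x \<in> greedy_union S N A i \<Longrightarrow> 0 < j \<Longrightarrow> j < N \<Longrightarrow> (S ^^ j) x \<notin> greedy_union S N A i"
proof (induction i arbitrary: x)
  case (Suc i)
  define G where "G = greedy_union S N A i"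
  have old: "(S ^^ j) x \<notin> G" if "x \<in> G" for x using Suc that unfolding G_def by blast
  have G: "y \<in> greedy_union S N A (Suc i) \<Longrightarrow> y \<in> G \<or> y \<in> A i \<and> (S ^^ j) y \<notin> G \<and> (inv S ^^ j) y \<notin> G" for y
    using Suc.prems(3) unfolding G_def by auto
  show ?case
  proof
    assume y: "(S ^^ j) x \<in> greedy_union S N A (Suc i)"
    from G[OF this] G[OF Suc.prems(1)] show False
      using old A[of x i j] Suc.prems(2,3) funpow_inv(2)[OF S, of j x] by auto
  qed
qed simp

text \<open>By maximality of the greedy choice, an aperiodic point lies fewer than \<open>N\<close>
  steps from a marker, in one direction or the other. Starting \<open>N\<close> steps ahead of
  \<open>x\<close> converts this two-sided distance into a forward hit.\<close>

lemma markers_exist: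
  fixes S :: "'a::metric_space \<Rightarrow> 'a" and U :: "nat \<Rightarrow> 'a set"
  assumes U: "countable_basis U" and S: "borel_automorphism S" and N: "N > 0"
  obtains M where "M \<in> sets borel" "M \<subseteq> aper S"
    "\<And>x j. x \<in> M \<Longrightarrow> 0 < j \<Longrightarrow> j < N \<Longrightarrow> (S ^^ j) x \<notin> M"
    "\<And>x. x \<in> aper S \<Longrightarrow> \<exists>j. 0 < j \<and> j < 2 * N \<and> (S ^^ j) x \<in> M"
proof -
  note bij = borel_automorphism_bij[OF S]
  \<comment> \<open>Every aperiodic point lies in some \<open>A i\<close>, since a basic open set
    separates it from its next \<open>N - 1\<close> iterates.\<close>
  define A where "A i = (aper S \<inter> U i) - (\<Union>j\<in>{0<..<N}. (S ^^ j) -` U i)" for i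
  define M where "M = (\<Union>i. greedy_union S N A i)"
  have A: "A i \<in> sets borel" for i
    unfolding A_def using aper_borel[OF U S] countable_basis_borel[OF U] funpow_vimage_borel(1)[OF S]
    by (intro sets.Diff sets.Int sets.finite_UN) auto
  have Asep: "(S ^^ j) x \<notin> A i" if "x \<in> A i" "0 < j" "j < N" for i x j
    using that unfolding A_def by auto
  show ?thesis
  proof (rule that[of M])
    show "M \<in> sets borel" unfolding M_def using greedy_union_borel[of S A, OF S A]
      by (intro sets.countable_UN image_subsetI)
    show "M \<subseteq> aper S"
    proof -
      have "greedy_union S N A i \<subseteq> aper S" for i
        using greedy_union_subset[of S N A i] by (rule order_trans) (auto simp: A_def)
      then show ?thesis unfolding M_def by (rule UN_least)
    qed
  next
    fix x j assume h: "x \<in> M" "0 < j" "j < N"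
    show "(S ^^ j) x \<notin> M"
    proof
      assume "(S ^^ j) x \<in> M"
      then obtain i k where "x \<in> greedy_union S N A i" "(S ^^ j) x \<in> greedy_union S N A k"
        using h(1) unfolding M_def by blast
      then have "x \<in> greedy_union S N A (max i k)" "(S ^^ j) x \<in> greedy_union S N A (max i k)"
        using greedy_union_mono[of i "max i k" S N A] greedy_union_mono[of k "max i k" S N A] by auto
      then show False using greedy_union_separated[of S A N, OF bij Asep _ h(2,3)] by blast
    qed
  next
    fix x assume "x \<in> aper S"
    define y where "y = (S ^^ N) x"
    have y: "y \<in> aper S" unfolding y_def using aper_funpow[OF bij] \<open>x \<in> aper S\<close> by blast
    have "y \<notin> (\<lambda>j. (S ^^ j) y) ` {0<..<N}"
    proof
      assume "y \<in> (\<lambda>j. (S ^^ j) y) ` {0<..<N}"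
      then obtain j where "0 < j" "(S ^^ j) y = y" by force
      then show False using y unfolding aper_iff by blast
    qed
    then obtain i where i: "y \<in> U i" "U i \<inter> (\<lambda>j. (S ^^ j) y) ` {0<..<N} = {}"
      using countable_basis_separates[OF U, of "(\<lambda>j. (S ^^ j) y) ` {0<..<N}" y] by auto
    then have "y \<in> A i" using y unfolding A_def by auto
    have "\<exists>j<N. (S ^^ j) y \<in> M \<or> (inv S ^^ j) y \<in> M"
    proof (cases "\<exists>j<N. (S ^^ j) y \<in> greedy_union S N A i \<or> (inv S ^^ j) y \<in> greedy_union S N A i")
      case True
      moreover have "greedy_union S N A i \<subseteq> M" unfolding M_def by (rule UN_upper) simp
      ultimately show ?thesis by blast
    next
      case False
      then have "y \<in> greedy_union S N A (Suc i)" using \<open>y \<in> A i\<close> by auto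
      then have "y \<in> M" unfolding M_def by (rule UN_I[OF UNIV_I])
      then have "(S ^^ 0) y \<in> M" by simp
      then show ?thesis using N by blast
    qed
    then obtain j where j: "j < N" "(S ^^ j) y \<in> M \<or> (inv S ^^ j) y \<in> M" by blast
    have "(S ^^ j) y = (S ^^ (j + N)) x" unfolding y_def by (simp only: funpow_plus)
    moreover have "(inv S ^^ j) y = (S ^^ (N - j)) x"
      unfolding y_def using funpow_inv_diff[OF bij_imp_bij_inv[OF bij], of j N x] j(1) inv_inv_eq[OF bij] by simp
    ultimately have "(S ^^ (j + N)) x \<in> M \<or> (S ^^ (N - j)) x \<in> M" using j(2) by simp
    moreover have "0 < j + N" "j + N < 2 * N" "0 < N - j" "N - j < 2 * N" using j(1) by auto
    ultimately show "\<exists>j. 0 < j \<and> j < 2 * N \<and> (S ^^ j) x \<in> M" by blast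
  qed
qed

section \<open>Measure bounds for sections and markers\<close>

lemma invariant_prob_measure:
  assumes \<mu>: "invariant_prob S \<mu>" and S: "borel_automorphism S" and E: "E \<in> sets borel"
  shows "measure \<mu> ((S ^^ n) ` E) = measure \<mu> E"
  using emeasure_funpow_image[OF assms] by (simp add: measure_def)

text \<open>A point of \<open>C\<close> with return time greater than \<open>1\<close> is sent by \<open>S\<close> into \<open>aper S - C\<close>.\<close>

lemma measure_section_le:
  assumes \<mu>: "invariant_prob S \<mu>" and S: "borel_automorphism S"
    and C: "C \<in> sets borel" "C \<subseteq> aper S" and A: "aper S \<in> sets borel"
  shows "2 * measure \<mu> C \<le> measure \<mu> (aper S) + measure \<mu> (C \<inter> S -` C)"
proof -
  interpret prob_space \<mu> using \<mu> by (simp add: invariant_prob_def)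
  have sets: "sets \<mu> = sets borel" using \<mu> by (simp add: invariant_prob_def)
  define E where "E = C - S -` C"
  have "S -` C \<in> sets borel" using funpow_vimage_borel(1)[OF S C(1), of 1] by simp
  then have b: "E \<in> sets borel" "C \<inter> S -` C \<in> sets borel" using C by (auto simp: E_def)
  have SE: "S ` E \<in> sets borel" using funpow_image_borel[OF S b(1), of 1] by simp
  have "measure \<mu> C = measure \<mu> (E \<union> (C \<inter> S -` C))" by (rule arg_cong[of _ _ "measure \<mu>"]) (auto simp: E_def)
  also have "\<dots> = measure \<mu> E + measure \<mu> (C \<inter> S -` C)"
    using b sets by (intro finite_measure_Union) (auto simp: E_def)
  finally have 1: "measure \<mu> C = measure \<mu> E + measure \<mu> (C \<inter> S -` C)" .
  have "measure \<mu> C + measure \<mu> (S ` E) = measure \<mu> (C \<union> S ` E)"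
    using C SE sets by (intro finite_measure_Union[symmetric]) (auto simp: E_def)
  also have "\<dots> \<le> measure \<mu> (aper S)"
  proof (intro finite_measure_mono)
    have "S x \<in> aper S" if "x \<in> E" for x
      using aper_funpow[OF borel_automorphism_bij[OF S], of 1 x] that C(2) by (auto simp: E_def)
    then show "C \<union> S ` E \<subseteq> aper S" using C(2) by auto
  qed (use A sets in simp)
  finally have "measure \<mu> C + measure \<mu> (S ` E) \<le> measure \<mu> (aper S)" .
  moreover have "measure \<mu> (S ` E) = measure \<mu> E"
    using invariant_prob_measure[OF \<mu> S b(1), of 1] by simp
  ultimately show ?thesis using 1 by simp
qed

text \<open>The first \<open>N\<close> images of \<open>M\<close>, starting with \<open>M\<close>
  itself, are pairwise disjoint and of equal measure inside a probability space.\<close>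

lemma measure_separated_le:
  fixes N :: nat
  assumes \<mu>: "invariant_prob S \<mu>" and S: "borel_automorphism S" and M: "M \<in> sets borel"
    and sep: "\<And>x j. x \<in> M \<Longrightarrow> 0 < j \<Longrightarrow> j < N \<Longrightarrow> (S ^^ j) x \<notin> M"
  shows "N * measure \<mu> M \<le> 1"
proof -
  interpret prob_space \<mu> using \<mu> by (simp add: invariant_prob_def)
  have sets: "sets \<mu> = sets borel" using \<mu> by (simp add: invariant_prob_def)
  have disj: "disjoint_family_on (\<lambda>j. (S ^^ j) ` M) {..<N}"
  proof -
    have "(S ^^ i) ` M \<inter> (S ^^ j) ` M = {}" if h: "i < j" "j < N" for i j
    proof -
      have False if xy: "x \<in> M" "y \<in> M" "(S ^^ i) x = (S ^^ j) y" for x y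
      proof -
        have "x = (S ^^ (j - i)) y"
          using funpow_cancel[OF borel_automorphism_bij[OF S] xy(3)] h(1) by simp
        then have "(S ^^ (j - i)) y \<in> M" using xy(1) by blast
        moreover have "0 < j - i" "j - i < N" using h by auto
        ultimately show False using sep[OF xy(2)] by blast
      qed
      then show ?thesis by blast
    qed
    note less = this
    have "(S ^^ i) ` M \<inter> (S ^^ j) ` M = {}" if "i \<noteq> j" "i < N" "j < N" for i j
      using less[of i j] less[of j i] that by (cases "i < j") auto
    then show ?thesis unfolding disjoint_family_on_def by simp
  qed
  have "N * measure \<mu> M = (\<Sum>j<N. measure \<mu> ((S ^^ j) ` M))"
    using invariant_prob_measure[OF \<mu> S M] by simp
  also have "\<dots> = measure \<mu> (\<Union>j<N. (S ^^ j) ` M)"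
    using disj funpow_image_borel[OF S M] sets by (intro finite_measure_finite_Union[symmetric]) auto
  finally show ?thesis by simp
qed

section \<open>Sections with prescribed return times\<close>

text \<open>Cut points placed in the gaps between markers have the piece lengths as return times.
  Markers that are sparse relative to \<open>R\<close> make return time \<open>1\<close> rare, and
  \<open>measure_section_le\<close> then gives the bound.\<close>

lemma section_with_return_times:
  fixes S :: "'a::metric_space \<Rightarrow> 'a" and U :: "nat \<Rightarrow> 'a set" and \<epsilon> :: real
  assumes U: "countable_basis U" and S: "borel_automorphism S"
    and s: "signature s" "primitive_sig s" "\<not> trivial_sig s" and \<epsilon>: "\<epsilon> > 0"
  obtains C where "C \<in> sets borel" "recurrent_section S C" "\<And>x. x \<in> C \<Longrightarrow> ret S C x \<in> s"
    "\<And>\<mu>. invariant_prob S \<mu> \<Longrightarrow> 2 * measure \<mu> C \<le> measure \<mu> (aper S) + \<epsilon>"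
proof -
  note bij = borel_automorphism_bij[OF S]
  obtain F R where FR: "\<And>L. L \<ge> F \<Longrightarrow> \<exists>P. cuts s R L P" using eventually_cuts[OF s] by blast
  \<comment> \<open>\<open>F \<le> N\<close> makes every gap long enough to be cut, and
    \<open>R / \<epsilon> \<le> N\<close> ensures that \<open>R\<close> levels over markers of
    measure at most \<open>1 / N\<close> weigh at most \<open>\<epsilon>\<close>.\<close>
  define N where "N = Suc (F + nat \<lceil>R / \<epsilon>\<rceil>)"
  have N: "N > 0" "F \<le> N" by (auto simp: N_def)
  have "R / \<epsilon> \<le> N" unfolding N_def by linarith
  then have R: "R \<le> \<epsilon> * N" using \<epsilon> by (simp add: field_simps)
  obtain M where M: "M \<in> sets borel" "M \<subseteq> aper S"
    and sep: "\<And>x j. x \<in> M \<Longrightarrow> 0 < j \<Longrightarrow> j < N \<Longrightarrow> (S ^^ j) x \<notin> M"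
    and hit: "\<And>x. x \<in> aper S \<Longrightarrow> \<exists>j. 0 < j \<and> j < 2 * N \<and> (S ^^ j) x \<in> M"
    by (rule markers_exist[OF U S N(1)]) (rule that; assumption)
  define L where "L = ret S M"
  have L: "0 < L x" "(S ^^ L x) x \<in> M" if x: "x \<in> aper S" for x
  proof -
    obtain j where "0 < j" "(S ^^ j) x \<in> M" using hit[OF x] by (elim exE conjE)
    then show "0 < L x" "(S ^^ L x) x \<in> M" unfolding L_def by (rule retI)+
  qed
  have NL: "N \<le> L x" if "x \<in> M" for x
  proof (rule ccontr)
    assume "\<not> N \<le> L x"
    then have "L x < N" by simp
    have "x \<in> aper S" using M(2) that by blast
    from L[OF this] show False using sep[OF that, of "L x"] \<open>L x < N\<close> by simp
  qed
  \<comment> \<open>The cutting depends on the gap length alone, so \<open>C\<close> is a countable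
    union of Borel pieces although the choice is arbitrary.\<close>
  define P where "P l = (SOME P. cuts s R l P)" for l
  have P: "cuts s R (L x) (P (L x))" if "x \<in> M" for x
    unfolding P_def by (rule someI_ex, rule FR, rule order_trans[OF N(2) NL[OF that]])
  have PL: "a < L x" if "x \<in> M" "a \<in> P (L x)" for x a
    using cuts_less[OF P[OF that(1)] that(2)] .
  define C where "C = (\<Union>j. (S ^^ j) ` (M \<inter> L -` {l. j \<in> P l}))"
  have C_iff: "y \<in> C \<longleftrightarrow> (\<exists>x\<in>M. \<exists>j\<in>P (L x). y = (S ^^ j) x)" for y
    unfolding C_def by auto
  have "L -` X \<in> sets borel" for X
    using measurable_sets_borel[OF measurable_ret[OF S M(1)], of X] unfolding L_def by simp
  then have "(S ^^ j) ` (M \<inter> L -` {l. j \<in> P l}) \<in> sets borel" for j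
    by (intro funpow_image_borel[OF S] sets.Int M(1))
  then have Cb: "C \<in> sets borel" unfolding C_def by (intro sets.countable_UN image_subsetI)
  \<comment> \<open>Uniqueness of tower positions shows that \<open>C\<close> meets each tower over
    a marker in the prescribed cut set and nothing else.\<close>
  have key: "(S ^^ a) x \<in> C \<longleftrightarrow> a \<in> P (L x)" if x: "x \<in> M" and a: "a < L x" for x a
  proof
    assume "(S ^^ a) x \<in> C"
    then obtain y j where y: "y \<in> M" "j \<in> P (L y)" "(S ^^ a) x = (S ^^ j) y" unfolding C_iff by blast
    have "x = y \<and> a = j"
      using tower_unique[OF bij x y(1) _ _ y(3)] a PL[OF y(1,2)] unfolding L_def by blast
    then show "a \<in> P (L x)" using y by simp
  qed (use x in \<open>auto simp: C_iff\<close>)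
  have MC: "x \<in> C" if "x \<in> M" for x
  proof -
    have "0 < L x" using L(1) that M(2) by blast
    then have "0 \<in> P (L x)" using cuts_zero[OF P[OF that]] by blast
    then have "(S ^^ 0) x \<in> C" using key[OF that \<open>0 < L x\<close>] by blast
    then show ?thesis by simp
  qed
  have CA: "C \<subseteq> aper S"
    using M(2) aper_funpow[OF bij] unfolding subset_iff C_iff by blast
  have rec: "recurrent_section S C"
  proof -
    have "(\<exists>m>0. (S ^^ m) x \<in> C) \<and> (\<exists>m>0. (inv S ^^ m) x \<in> C)" if x: "x \<in> aper S" for x
    proof
      show "\<exists>m>0. (S ^^ m) x \<in> C" using hit[OF x] MC by blast
      \<comment> \<open>Going back \<open>2 * N\<close> steps and then forward to a marker in fewer
        than \<open>2 * N\<close> steps ends strictly before \<open>x\<close>.\<close>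
      have "(inv S ^^ (2 * N)) x \<in> aper S" using x aper_inv_funpow[OF bij] by blast
      from hit[OF this] obtain j where "j < 2 * N" "(S ^^ j) ((inv S ^^ (2 * N)) x) \<in> M" by blast
      then have "(inv S ^^ (2 * N - j)) x \<in> M" "0 < 2 * N - j"
        using funpow_inv_diff[OF bij, of j "2 * N" x] by auto
      then show "\<exists>m>0. (inv S ^^ m) x \<in> C" using MC by blast
    qed
    then show ?thesis unfolding recurrent_section_def using CA by blast
  qed
  have ret: "ret S C y \<in> s" if y: "y \<in> C" for y
  proof -
    obtain x j where x: "x \<in> M" "j \<in> P (L x)" "y = (S ^^ j) x" using y unfolding C_iff by blast
    have "\<exists>m\<in>s. j + m \<in> insert (L x) (P (L x)) \<and> (\<forall>i. 0 < i \<and> i < m \<longrightarrow> j + i \<notin> P (L x))"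
      by (rule cuts_step[OF P[OF x(1)] x(2)])
    then obtain m where m: "m \<in> s" "j + m \<in> insert (L x) (P (L x))"
      "\<And>i. 0 < i \<Longrightarrow> i < m \<Longrightarrow> j + i \<notin> P (L x)" by blast
    have jm: "j + m \<le> L x" using m(2) PL[OF x(1)] by force
    have pow: "(S ^^ i) y = (S ^^ (j + i)) x" for i
      using funpow_plus[of i j S x] x(3) by (simp add: add.commute)
    have "m > 0" using s(1) m(1) by (simp add: signature_def)
    \<comment> \<open>At the end of the gap the target is the next marker, which lies in
      \<open>C\<close> because \<open>0\<close> is a cut point of every gap.\<close>
    moreover have "(S ^^ m) y \<in> C"
    proof (cases "j + m = L x")
      case True
      then show ?thesis using L(2)[of x] M(2) x(1) MC pow[of m] by auto
    next
      case False
      then show ?thesis using m(2) jm key[OF x(1), of "j + m"] pow[of m] by auto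
    qed
    moreover have "(S ^^ i) y \<notin> C" if "0 < i" "i < m" for i
      using key[OF x(1), of "j + i"] m(3)[OF that] jm that(2) pow[of i] by auto
    ultimately have "ret S C y = m" by (rule ret_eqI)
    then show ?thesis using m(1) by simp
  qed
  \<comment> \<open>A point with return time \<open>1\<close> starts a unit step, and these are
    confined to the first \<open>R\<close> levels above the markers.\<close>
  have D: "C \<inter> S -` C \<subseteq> (\<Union>j<R. (S ^^ j) ` M)"
  proof
    fix y assume y: "y \<in> C \<inter> S -` C"
    then have "y \<in> C" by blast
    then obtain x j where x: "x \<in> M" "j \<in> P (L x)" "y = (S ^^ j) x" unfolding C_iff by blast
    have "(S ^^ Suc j) x \<in> C" using y x(3) by simp
    then have "Suc j \<in> insert (L x) (P (L x))"
      using key[OF x(1), of "Suc j"] PL[OF x(1,2)] by fastforce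
    then have "j < R" by (rule cuts_unit_step[OF P[OF x(1)] x(2)])
    then show "y \<in> (\<Union>j<R. (S ^^ j) ` M)" using x by blast
  qed
  have "2 * measure \<mu> C \<le> measure \<mu> (aper S) + \<epsilon>" if \<mu>: "invariant_prob S \<mu>" for \<mu>
  proof -
    interpret prob_space \<mu> using \<mu> by (simp add: invariant_prob_def)
    have sets: "sets \<mu> = sets borel" using \<mu> by (simp add: invariant_prob_def)
    have "measure \<mu> (C \<inter> S -` C) \<le> measure \<mu> (\<Union>j<R. (S ^^ j) ` M)"
      using funpow_image_borel[OF S M(1)] sets by (intro finite_measure_mono D sets.finite_UN) auto
    also have "\<dots> \<le> (\<Sum>j<R. measure \<mu> ((S ^^ j) ` M))"
      using funpow_image_borel[OF S M(1)] sets by (intro finite_measure_subadditive_finite) auto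
    also have "\<dots> = R * measure \<mu> M" using invariant_prob_measure[OF \<mu> S M(1)] by simp
    also have "\<dots> \<le> \<epsilon> * (N * measure \<mu> M)" using R by (metis measure_nonneg mult.assoc mult_right_mono)
    also have "\<dots> \<le> \<epsilon>" using measure_separated_le[OF \<mu> S M(1) sep] \<epsilon> by (simp add: mult_le_cancel_left1)
    finally have "measure \<mu> (C \<inter> S -` C) \<le> \<epsilon>" .
    then show ?thesis using measure_section_le[OF \<mu> S Cb CA aper_borel[OF U S]] by linarith
  qed
  then show ?thesis using that Cb rec ret by blast
qed

section \<open>Iterated inducing\<close>

text \<open>Dependent choice over automorphisms alone: by \<open>aper_induced\<close>, the section
  used at each stage is recovered as the aperiodic part of the next map.\<close>

lemma induced_sequence_exists:
  fixes T :: "'a::metric_space \<Rightarrow> 'a" and U :: "nat \<Rightarrow> 'a set" and s :: "nat \<Rightarrow> nat set"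
  assumes U: "countable_basis U" and T: "borel_automorphism T"
    and s: "\<And>k. signature (s (Suc k)) \<and> primitive_sig (s (Suc k)) \<and> \<not> trivial_sig (s (Suc k))"
  obtains R where "R 0 = T" "\<And>k. borel_automorphism (R k)"
    "\<And>k. recurrent_section (R k) (aper (R (Suc k)))" "\<And>k. R (Suc k) = induced (R k) (aper (R (Suc k)))"
    "\<And>k x. x \<in> aper (R (Suc k)) \<Longrightarrow> ret (R k) (aper (R (Suc k))) x \<in> s (Suc k)"
    "\<And>k \<mu>. invariant_prob (R k) \<mu> \<Longrightarrow> invariant_prob (R (Suc k)) \<mu>"
    "\<And>k \<mu>. invariant_prob (R k) \<mu> \<Longrightarrow> 2 * measure \<mu> (aper (R (Suc k))) \<le> measure \<mu> (aper (R k)) + (1 / 2) ^ k"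
proof -
  define Q where "Q k S S' \<longleftrightarrow> recurrent_section S (aper S') \<and> S' = induced S (aper S')
    \<and> (\<forall>x\<in>aper S'. ret S (aper S') x \<in> s (Suc k))
    \<and> (\<forall>\<mu>. invariant_prob S \<mu> \<longrightarrow> invariant_prob S' \<mu> \<and> 2 * measure \<mu> (aper S') \<le> measure \<mu> (aper S) + (1 / 2) ^ k)"
    for k and S S' :: "'a \<Rightarrow> 'a"
  \<comment> \<open>The condition \<open>k = 0 \<longrightarrow> S = T\<close> fixes the initial
    value in the dependent choice; at successors it is vacuous.\<close>
  have step: "\<exists>S'. (borel_automorphism S' \<and> (Suc k = 0 \<longrightarrow> S' = T)) \<and> Q k S S'"
    if S': "borel_automorphism S \<and> (k = 0 \<longrightarrow> S = T)" for k S
  proof -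
    have S: "borel_automorphism S" using S' by blast
    have sk: "signature (s (Suc k))" "primitive_sig (s (Suc k))" "\<not> trivial_sig (s (Suc k))" using s by blast+
    have pos: "0 < (1 / 2 :: real) ^ k" by simp
    obtain C where C: "C \<in> sets borel" "recurrent_section S C" "\<And>x. x \<in> C \<Longrightarrow> ret S C x \<in> s (Suc k)"
      "\<And>\<mu>. invariant_prob S \<mu> \<Longrightarrow> 2 * measure \<mu> C \<le> measure \<mu> (aper S) + (1 / 2) ^ k"
      by (rule section_with_return_times[OF U S sk pos]) (rule that; assumption)
    have a: "aper (induced S C) = C" by (rule aper_induced[OF borel_automorphism_bij[OF S] C(2)])
    note i = induced_automorphism[OF S C(2,1)]
    have "Q k S (induced S C)" unfolding Q_def a using C i(2) by (intro conjI ballI allI impI) auto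
    then show ?thesis using i(1) by blast
  qed
  have "\<exists>R. \<forall>k. (borel_automorphism (R k) \<and> (k = 0 \<longrightarrow> R k = T)) \<and> Q k (R k) (R (Suc k))"
    by (rule dependent_nat_choice[of "\<lambda>k S. borel_automorphism S \<and> (k = 0 \<longrightarrow> S = T)" Q])
      (use T in blast, rule step)
  then obtain R where R: "\<And>k. borel_automorphism (R k) \<and> (k = 0 \<longrightarrow> R k = T)" "\<And>k. Q k (R k) (R (Suc k))"
    by blast
  show ?thesis
    by (rule that[of R]) (use R in \<open>simp_all add: Q_def\<close>)
qed

section \<open>Discarding a null set of orbits\<close>

text \<open>Invariance makes every iterated preimage of \<open>Z\<close> null, under
  \<open>T\<close> as well as its inverse, and there are countably many of them.\<close>

lemma aper_diff_orbits_full: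
  assumes \<mu>: "invariant_prob T \<mu>" and T: "borel_automorphism T" and A: "aper T \<in> sets borel"
    and AE: "AE x in \<mu>. x \<in> aper T" and Z: "Z \<in> sets borel" "emeasure \<mu> Z = 0"
  shows "emeasure \<mu> (aper T - (\<Union>n. (T ^^ n) -` Z \<union> (inv T ^^ n) -` Z)) = 1"
proof -
  interpret prob_space \<mu> using \<mu> by (simp add: invariant_prob_def)
  have sets: "sets \<mu> = sets borel" using \<mu> by (simp add: invariant_prob_def)
  have "emeasure \<mu> ((T ^^ n) -` Z) = 0" "emeasure \<mu> ((inv T ^^ n) -` Z) = 0" for n
    using emeasure_funpow_vimage[OF \<mu> T Z(1), of n] emeasure_funpow_image[OF \<mu> T Z(1), of n]
      funpow_image_vimage[OF borel_automorphism_bij[OF T], of n Z] Z(2) by simp_all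
  then have null: "(T ^^ n) -` Z \<union> (inv T ^^ n) -` Z \<in> null_sets \<mu>" for n
    using funpow_vimage_borel[OF T Z(1)] sets by (intro null_sets.Un null_setsI) auto
  then have "(\<Union>n. (T ^^ n) -` Z \<union> (inv T ^^ n) -` Z) \<in> null_sets \<mu>" by (rule null_sets_UN)
  note N = this
  have "AE x in \<mu>. x \<in> aper T - (\<Union>n. (T ^^ n) -` Z \<union> (inv T ^^ n) -` Z)"
    using AE AE_not_in[OF N] by eventually_elim blast
  moreover have "aper T - (\<Union>n. (T ^^ n) -` Z \<union> (inv T ^^ n) -` Z) \<in> sets \<mu>"
    using A sets N by (intro sets.Diff) auto
  ultimately show ?thesis by (simp add: emeasure_eq_1_AE)
qed

text \<open>The measures of the decreasing sets converge to the measure \<open>b\<close> of the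
  intersection. As the errors tend to zero, the halving inequality becomes
  \<open>2 * b \<le> b\<close> in the limit.\<close>

lemma aper_inter_null:
  fixes R :: "nat \<Rightarrow> 'a::topological_space \<Rightarrow> 'a"
  assumes \<mu>: "invariant_prob (R 0) \<mu>" and B: "\<And>k. aper (R k) \<in> sets borel"
    and mono: "\<And>k. aper (R (Suc k)) \<subseteq> aper (R k)"
    and inv: "\<And>k. invariant_prob (R k) \<mu> \<Longrightarrow> invariant_prob (R (Suc k)) \<mu>"
    and half: "\<And>k. invariant_prob (R k) \<mu> \<Longrightarrow> 2 * measure \<mu> (aper (R (Suc k))) \<le> measure \<mu> (aper (R k)) + (1 / 2) ^ k"
  shows "emeasure \<mu> (\<Inter>k. aper (R k)) = 0"
proof -
  interpret prob_space \<mu> using \<mu> by (simp add: invariant_prob_def)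
  have sets: "sets \<mu> = sets borel" using \<mu> by (simp add: invariant_prob_def)
  have inv': "invariant_prob (R k) \<mu>" for k by (induction k) (use \<mu> inv in auto)
  define b where "b = measure \<mu> (\<Inter>k. aper (R k))"
  have lim: "(\<lambda>k. measure \<mu> (aper (R k))) \<longlonglongrightarrow> b"
    unfolding b_def using B sets mono by (intro finite_Lim_measure_decseq decseq_SucI) auto
  have lim2: "(\<lambda>k. 2 * measure \<mu> (aper (R (Suc k)))) \<longlonglongrightarrow> 2 * b"
    by (intro tendsto_mult tendsto_const LIMSEQ_Suc[OF lim])
  have lim3: "(\<lambda>k. measure \<mu> (aper (R k)) + (1 / 2) ^ k) \<longlonglongrightarrow> b + 0"
    by (intro tendsto_add lim LIMSEQ_power_zero) simp
  have "2 * b \<le> b + 0" by (rule LIMSEQ_le[OF lim2 lim3]) (use half[OF inv'] in blast)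
  then have "b = 0" using measure_nonneg[of \<mu> "\<Inter>k. aper (R k)"] by (simp add: b_def)
  then show ?thesis by (simp add: b_def emeasure_eq_measure)
qed

section \<open>Positions in stacked blocks\<close>

text \<open>Division with remainder for blocks of varying lengths: \<open>p\<close> is the block and
  \<open>j\<close> the offset inside it. This locates a level of a large tower in one of the smaller
  towers stacked in it.\<close>

lemma less_sum_nat_decompose:
  fixes f :: "nat \<Rightarrow> nat"
  assumes "i < (\<Sum>l<m. f l)"
  obtains p j where "p < m" "j < f p" "i = (\<Sum>l<p. f l) + j"
proof -
  have "\<exists>p j. p < m \<and> j < f p \<and> i = (\<Sum>l<p. f l) + j" using assms
  proof (induction m)
    case (Suc m)
    show ?case
    proof (cases "i < (\<Sum>l<m. f l)")
      case True
      then show ?thesis using Suc.IH by (metis less_SucI)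
    next
      case False
      then have "i = (\<Sum>l<m. f l) + (i - (\<Sum>l<m. f l))" "i - (\<Sum>l<m. f l) < f m" using Suc.prems by auto
      then show ?thesis by blast
    qed
  qed simp
  then show ?thesis using that by blast
qed

lemma less_sum_nat_compose:
  fixes f :: "nat \<Rightarrow> nat"
  assumes "p < m" "j < f p"
  shows "(\<Sum>l<p. f l) + j < (\<Sum>l<m. f l)"
proof -
  have "(\<Sum>l<p. f l) + j < (\<Sum>l<Suc p. f l)" using assms(2) by simp
  also have "\<dots> \<le> (\<Sum>l<m. f l)" using assms(1) by (intro sum_mono2) auto
  finally show ?thesis .
qed

text \<open>The height of \<open>x\<close> in its tower over \<open>C\<close>. Counting backwards
  avoids naming the base point and makes the height a Borel function.\<close>

definition off :: "('a \<Rightarrow> 'a) \<Rightarrow> 'a set \<Rightarrow> 'a \<Rightarrow> nat" where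
  "off S C x = (LEAST j. (inv S ^^ j) x \<in> C)"

lemma off_tower:
  assumes S: "bij S" and b: "b \<in> C" "j < ret S C b"
  shows "off S C ((S ^^ j) b) = j"
  unfolding off_def
proof (rule Least_equality)
  show "(inv S ^^ j) ((S ^^ j) b) \<in> C" using b(1) funpow_inv(2)[OF S] by simp
next
  fix i assume i: "(inv S ^^ i) ((S ^^ j) b) \<in> C"
  show "j \<le> i"
  proof (rule ccontr)
    assume "\<not> j \<le> i"
    then have "i < j" by simp
    then have "(inv S ^^ i) ((S ^^ j) b) = (S ^^ (j - i)) b"
      using funpow_inv_diff[OF bij_imp_bij_inv[OF S], of i j b] inv_inv_eq[OF S] by simp
    moreover have "(S ^^ (j - i)) b \<notin> C" using \<open>i < j\<close> b(2) by (intro not_before_ret) auto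
    ultimately show False using i by simp
  qed
qed

lemma measurable_off:
  assumes S: "borel_automorphism S" and C: "C \<in> sets borel"
  shows "off S C \<in> measurable borel (count_space UNIV)"
proof -
  have "Measurable.pred borel (\<lambda>x. (inv S ^^ j) x \<in> C)" for j
    using funpow_vimage_borel(2)[OF S C, of j] by (simp add: pred_def vimage_def)
  then show ?thesis unfolding off_def[abs_def] by (rule measurable_Least)
qed

text \<open>Points are equal iff each basic open set contains both or neither. The tower relations
  will be pulled back from the diagonal.\<close>

lemma diagonal_borel:
  fixes U :: "nat \<Rightarrow> 'a::metric_space set"
  assumes U: "countable_basis U"
  shows "{(x, y). x = y} \<in> sets (borel \<Otimes>\<^sub>M (borel :: 'a measure))"
proof -
  have "(x, y) \<in> (\<Inter>i. U i \<times> U i \<union> (- U i) \<times> (- U i)) \<longleftrightarrow> x = y" for x y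
    using countable_basis_separates[OF U, of "{y}" x] by auto
  then have "{(x, y). x = y} = (\<Inter>i. U i \<times> U i \<union> (- U i) \<times> (- U i))" by auto
  moreover have "U i \<times> U i \<union> (- U i) \<times> (- U i) \<in> sets (borel \<Otimes>\<^sub>M borel)" for i
    using countable_basis_borel[OF U] by (intro sets.Un pair_measureI) auto
  then have "(\<Inter>i. U i \<times> U i \<union> (- U i) \<times> (- U i)) \<in> sets (borel \<Otimes>\<^sub>M borel)"
    by (intro sets.countable_INT image_subsetI UNIV_not_empty)
  ultimately show ?thesis by simp
qed

section \<open>The filtration by towers\<close>

text \<open>The outcome of the iteration, restricted to an invariant Borel set \<open>Y\<close> each
  of whose points eventually leaves the aperiodic parts. No measure is involved from here on; the
  arguments are combinatorial and Borel.\<close>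

locale induced_tower =
  fixes T :: "'a::metric_space \<Rightarrow> 'a" and R :: "nat \<Rightarrow> 'a \<Rightarrow> 'a" and s :: "nat \<Rightarrow> nat set"
    and U :: "nat \<Rightarrow> 'a set" and Y :: "'a set"
  assumes U: "countable_basis U"
    and R0: "R 0 = T" and aut: "\<And>k. borel_automorphism (R k)"
    and section_R: "\<And>k. recurrent_section (R k) (aper (R (Suc k)))"
    and R_Suc: "\<And>k. R (Suc k) = induced (R k) (aper (R (Suc k)))"
    and ret_s: "\<And>k x. x \<in> aper (R (Suc k)) \<Longrightarrow> ret (R k) (aper (R (Suc k))) x \<in> s (Suc k)"
    and finite_s: "\<And>k. finite (s (Suc k))"
    and Y_borel: "Y \<in> sets borel" and Y_aper: "Y \<subseteq> aper T"
    and Y_inv: "\<And>n x. (T ^^ n) x \<in> Y \<longleftrightarrow> x \<in> Y"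
    and Y_vanish: "\<And>x. x \<in> Y \<Longrightarrow> \<exists>k. x \<notin> aper (R k)"
begin

definition B :: "nat \<Rightarrow> 'a set" where "B k = aper (R k)"

text \<open>\<open>h\<close> counts steps of \<open>T\<close>, so it is a tower height. In contrast,
  \<open>r\<close> counts steps of \<open>R k\<close>: it is the number of level-\<open>k\<close>
  towers stacked into one tower of the next level, and it is this number that lies in the
  signature.\<close>

definition h :: "nat \<Rightarrow> 'a \<Rightarrow> nat" where "h k = ret T (B k)"

definition r :: "nat \<Rightarrow> 'a \<Rightarrow> nat" where "r k = ret (R k) (B (Suc k))"

lemma bij_R: "bij (R k)"
  using aut by (rule borel_automorphism_bij)

lemma bij_T: "bij T"
  using bij_R[of 0] R0 by simp

lemma aut_T: "borel_automorphism T"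
  using aut[of 0] R0 by simp

lemma B_borel: "B k \<in> sets borel"
  unfolding B_def by (rule aper_borel[OF U aut])

lemma B_0: "B 0 = aper T"
  by (simp add: B_def R0)

lemma section_B: "recurrent_section (R k) (B (Suc k))"
  unfolding B_def by (rule section_R)

lemma B_Suc_subset: "B (Suc k) \<subseteq> B k"
  using section_R[of k] unfolding recurrent_section_def B_def by blast

lemma B_antimono: "i \<le> k \<Longrightarrow> B k \<subseteq> B i"
  by (rule lift_Suc_antimono_le[of B]) (rule B_Suc_subset)

lemma B_aper: "B k \<subseteq> aper T"
  using B_antimono[of 0 k] B_0 by simp

lemma R_B: "x \<in> B k \<Longrightarrow> (R k ^^ n) x \<in> B k"
  unfolding B_def using aper_funpow[OF bij_R] by blast

lemma r_props:
  assumes "x \<in> B (Suc k)"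
  shows "0 < r k x" "(R k ^^ r k x) x \<in> B (Suc k)" "r k x \<in> s (Suc k)"
    "R (Suc k) x = (R k ^^ r k x) x"
proof -
  have "x \<in> aper (R k)" using assms B_Suc_subset by (auto simp: B_def)
  from recurrent_section_ret[OF section_B this] show "0 < r k x" "(R k ^^ r k x) x \<in> B (Suc k)"
    unfolding r_def by blast+
  show "r k x \<in> s (Suc k)" using ret_s[of x k] assms by (simp add: r_def B_def)
  have "R (Suc k) x = induced (R k) (B (Suc k)) x" using R_Suc[of k] by (simp add: B_def)
  then show "R (Suc k) x = (R k ^^ r k x) x" using assms by (simp add: induced_simps(1) r_def)
qed

section \<open>Iterated return times as return times of \<open>T\<close>\<close>

text \<open>The induction statement that repeated inducing amounts to inducing once: on
  \<open>B k\<close>, the map \<open>R k\<close> is the first return map of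
  \<open>T\<close>.\<close>

definition tower_level :: "nat \<Rightarrow> bool" where
  "tower_level k \<longleftrightarrow> recurrent_section T (B k) \<and> (\<forall>x\<in>B k. R k x = (T ^^ h k x) x)"

lemma tower_level_0: "tower_level 0"
proof -
  have "(T ^^ 1) x \<in> B 0" "(inv T ^^ 1) x \<in> B 0" if "x \<in> aper T" for x
    unfolding B_0 using that aper_funpow[OF bij_T] aper_inv_funpow[OF bij_T] by blast+
  then have "recurrent_section T (B 0)"
    unfolding recurrent_section_def using B_0 by (metis order_refl zero_less_one)
  moreover have "R 0 x = (T ^^ h 0 x) x" if "x \<in> B 0" for x
  proof -
    have "(T ^^ 1) x \<in> B 0" unfolding B_0 using that B_0 aper_funpow[OF bij_T] by blast
    then have "h 0 x = 1" unfolding h_def by (intro ret_eqI) auto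
    then show ?thesis using R0 by simp
  qed
  ultimately show ?thesis unfolding tower_level_def by blast
qed

lemma level_R_funpow:
  assumes "tower_level k" "x \<in> B k"
  shows "(R k ^^ n) x = (T ^^ (\<Sum>i<n. h k ((R k ^^ i) x))) x"
proof (induction n)
  case (Suc n)
  have "(R k ^^ Suc n) x = R k ((R k ^^ n) x)" by simp
  also have "\<dots> = (T ^^ h k ((R k ^^ n) x)) ((R k ^^ n) x)"
    using assms R_B unfolding tower_level_def by blast
  also have "\<dots> = (T ^^ (h k ((R k ^^ n) x) + (\<Sum>i<n. h k ((R k ^^ i) x)))) x"
    unfolding funpow_plus using Suc by simp
  finally show ?case by (simp add: add.commute)
qed simp

lemma level_h_pos:
  assumes "tower_level k" "x \<in> B k"
  shows "0 < h k x"
proof -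
  have "recurrent_section T (B k)" "x \<in> aper T" using assms B_aper by (auto simp: tower_level_def)
  then show ?thesis unfolding h_def by (rule recurrent_section_ret(1))
qed

text \<open>No earlier return is possible: a time before the sum falls into some block, can hit
  \<open>B k\<close> only at offset \<open>0\<close>, and is then an iterate of \<open>R k\<close>
  before its own first return to \<open>B (Suc k)\<close>.\<close>

lemma level_h_Suc:
  assumes "tower_level k" "b \<in> B (Suc k)"
  shows "h (Suc k) b = (\<Sum>i<r k b. h k ((R k ^^ i) b))"
  unfolding h_def[of "Suc k"]
proof (rule ret_eqI)
  have bk: "b \<in> B k" using assms(2) B_Suc_subset by blast
  have "(\<Sum>i<0. h k ((R k ^^ i) b)) + 0 < (\<Sum>i<r k b. h k ((R k ^^ i) b))"
    by (rule less_sum_nat_compose[OF r_props(1)[OF assms(2)] level_h_pos[OF assms(1) R_B[OF bk]]])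
  then show "0 < (\<Sum>i<r k b. h k ((R k ^^ i) b))" by simp
  show "(T ^^ (\<Sum>i<r k b. h k ((R k ^^ i) b))) b \<in> B (Suc k)"
    using level_R_funpow[OF assms(1) bk, of "r k b"] r_props(2)[OF assms(2)] by simp
  fix i assume i: "0 < i" "i < (\<Sum>i<r k b. h k ((R k ^^ i) b))"
  obtain p j where pj: "p < r k b" "j < h k ((R k ^^ p) b)" "i = (\<Sum>l<p. h k ((R k ^^ l) b)) + j"
    using less_sum_nat_decompose[OF i(2)] .
  have Ti: "(T ^^ i) b = (T ^^ j) ((R k ^^ p) b)"
    unfolding level_R_funpow[OF assms(1) bk, of p] funpow_plus[symmetric] pj(3) by (simp add: add.commute)
  show "(T ^^ i) b \<notin> B (Suc k)"
  proof
    assume in_B: "(T ^^ i) b \<in> B (Suc k)"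
    then have "(T ^^ j) ((R k ^^ p) b) \<in> B k" using B_Suc_subset Ti by auto
    then have "j = 0" using not_before_ret[of j T "B k" "(R k ^^ p) b"] pj(2) unfolding h_def by blast
    then have "0 < p" using i(1) pj(3) by (cases p) auto
    then have "(R k ^^ p) b \<notin> B (Suc k)" using pj(1) unfolding r_def by (intro not_before_ret)
    then show False using in_B Ti \<open>j = 0\<close> by simp
  qed
qed

text \<open>Visits to \<open>B (Suc k)\<close> are sought from the base point \<open>y\<close> of
  the level-\<open>k\<close> tower through \<open>x\<close>: recurrence of \<open>R k\<close>
  provides them, and sums of heights turn steps of \<open>R k\<close> into steps of
  \<open>T\<close>.\<close>

lemma tower_level_Suc:
  assumes "tower_level k"
  shows "tower_level (Suc k)"
proof -
  have rec: "recurrent_section T (B k)" using assms unfolding tower_level_def by blast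
  have "(\<exists>m>0. (T ^^ m) x \<in> B (Suc k)) \<and> (\<exists>m>0. (inv T ^^ m) x \<in> B (Suc k))" if x: "x \<in> aper T" for x
  proof
    obtain y j where y: "y \<in> B k" "j < ret T (B k) y" "x = (T ^^ j) y"
      using tower_exists[OF bij_T rec x] .
    have yR: "y \<in> aper (R k)" using y(1) by (simp add: B_def)
    obtain n where n: "n > 0" "(R k ^^ n) y \<in> B (Suc k)"
      using section_B[of k] yR unfolding recurrent_section_def by blast
    define N where "N = (\<Sum>i<n. h k ((R k ^^ i) y))"
    \<comment> \<open>The case \<open>p = 0\<close> of block arithmetic: the height \<open>j\<close>
      of \<open>x\<close> lies within the first block, hence below the time \<open>N\<close> of the
      visit.\<close>
    have "(\<Sum>i<0. h k ((R k ^^ i) y)) + j < N"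
      unfolding N_def by (rule less_sum_nat_compose) (use n y(2) in \<open>auto simp: h_def\<close>)
    then have "0 < N - j" "N - j + j = N" by auto
    moreover have "(T ^^ (N - j)) x = (T ^^ (N - j + j)) y" unfolding funpow_plus y(3) ..
    moreover have "(T ^^ N) y \<in> B (Suc k)" using level_R_funpow[OF assms y(1), of n] n(2) by (simp add: N_def)
    ultimately show "\<exists>m>0. (T ^^ m) x \<in> B (Suc k)" by metis
    obtain n where n: "n > 0" "(inv (R k) ^^ n) y \<in> B (Suc k)"
      using section_B[of k] yR unfolding recurrent_section_def by blast
    define z where "z = (inv (R k) ^^ n) y"
    have z: "z \<in> B (Suc k)" using n by (simp add: z_def)
    then have zk: "z \<in> B k" using B_Suc_subset by blast
    define N where "N = (\<Sum>i<n. h k ((R k ^^ i) z))"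
    have "y = (R k ^^ n) z" unfolding z_def using funpow_inv(1)[OF bij_R] by simp
    then have "x = (T ^^ (j + N)) z" using y(3) level_R_funpow[OF assms zk, of n] funpow_plus[of j N T z] by (simp add: N_def)
    then have "(inv T ^^ (j + N)) x = z" using funpow_inv(2)[OF bij_T] by simp
    moreover have "(\<Sum>i<0. h k ((R k ^^ i) z)) + 0 < N" unfolding N_def
      by (rule less_sum_nat_compose[OF n(1) level_h_pos[OF assms R_B[OF zk]]])
    ultimately show "\<exists>m>0. (inv T ^^ m) x \<in> B (Suc k)" using z by (metis add_gr_0 not_gr_zero add_0 sum.empty lessThan_0)
  qed
  then have "recurrent_section T (B (Suc k))" unfolding recurrent_section_def using B_aper by blast
  moreover have "R (Suc k) x = (T ^^ h (Suc k) x) x" if "x \<in> B (Suc k)" for x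
    using r_props(4)[OF that] level_h_Suc[OF assms that] level_R_funpow[OF assms, of x "r k x"] that B_Suc_subset
    by auto
  ultimately show ?thesis unfolding tower_level_def by blast
qed

lemma tower_level: "tower_level k"
  by (induction k) (auto intro: tower_level_0 tower_level_Suc)

lemmas R_funpow = level_R_funpow[OF tower_level]
lemmas h_pos = level_h_pos[OF tower_level]
lemmas h_Suc = level_h_Suc[OF tower_level]

lemma recurrent_B: "recurrent_section T (B k)"
  using tower_level[of k] unfolding tower_level_def by blast

lemma h_0: "x \<in> B 0 \<Longrightarrow> h 0 x = 1"
  unfolding h_def by (rule ret_eqI) (use aper_funpow[OF bij_T, of 1 x] B_0 in auto)

text \<open>A tower stacks at most \<open>Max (s (Suc k))\<close> towers of the previous level, so
  finiteness of the signatures bounds the heights by induction.\<close>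

lemma h_bounded: "\<exists>H. \<forall>x\<in>B k. h k x \<le> H"
proof (induction k)
  case 0
  then show ?case using h_0 by (intro exI[of _ 1]) auto
next
  case (Suc k)
  then obtain H where H: "\<And>x. x \<in> B k \<Longrightarrow> h k x \<le> H" by blast
  have "h (Suc k) x \<le> Max (s (Suc k)) * H" if x: "x \<in> B (Suc k)" for x
  proof -
    have "x \<in> B k" using x B_Suc_subset by blast
    then have "h (Suc k) x \<le> r k x * H"
      unfolding h_Suc[OF x] using sum_bounded_above[of "{..<r k x}" "\<lambda>i. h k ((R k ^^ i) x)" H] H[OF R_B] by simp
    also have "\<dots> \<le> Max (s (Suc k)) * H" using r_props(3)[OF x] finite_s by (intro mult_le_mono1 Max_ge)
    finally show ?thesis .
  qed
  then show ?case by blast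
qed

lemma sub_tower:
  assumes b: "b \<in> B (Suc k)" and p: "p < r k b" and j: "j < h k ((R k ^^ p) b)"
  defines "i \<equiv> (\<Sum>l<p. h k ((R k ^^ l) b)) + j"
  shows "(T ^^ j) ((R k ^^ p) b) = (T ^^ i) b" "i < h (Suc k) b"
proof -
  have "b \<in> B k" using b B_Suc_subset by blast
  from R_funpow[OF this, of p] show "(T ^^ j) ((R k ^^ p) b) = (T ^^ i) b"
    unfolding i_def using funpow_plus[of j "\<Sum>l<p. h k ((R k ^^ l) b)" T b] by (simp add: add.commute)
  show "i < h (Suc k) b" unfolding h_Suc[OF b] i_def by (rule less_sum_nat_compose[where f = "\<lambda>l. h k ((R k ^^ l) b)", OF p j])
qed

lemma sub_tower_exists:
  assumes b: "b \<in> B (Suc k)" and i: "i < h (Suc k) b"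
  obtains p j where "p < r k b" "j < h k ((R k ^^ p) b)" "i = (\<Sum>l<p. h k ((R k ^^ l) b)) + j"
    "(T ^^ i) b = (T ^^ j) ((R k ^^ p) b)"
proof -
  obtain p j where pj: "p < r k b" "j < h k ((R k ^^ p) b)" "i = (\<Sum>l<p. h k ((R k ^^ l) b)) + j"
    using less_sum_nat_decompose[OF i[unfolded h_Suc[OF b]]] .
  then show ?thesis using that sub_tower(1)[OF b pj(1,2)] by simp
qed

lemma R_Y: "x \<in> B k \<Longrightarrow> x \<in> Y \<Longrightarrow> (R k ^^ n) x \<in> Y"
  using R_funpow[of x k n] Y_inv by simp

lemma tower_point_unique:
  assumes "a \<in> B k" "b \<in> B k" "i < h k a" "j < h k b" "(T ^^ i) a = (T ^^ j) b"
  shows "a = b \<and> i = j"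
  using tower_unique[OF bij_T assms(1,2)] assms(3-5) unfolding h_def by blast

lemma Y_tower_exists:
  assumes "x \<in> Y"
  obtains b j where "b \<in> B k" "b \<in> Y" "j < h k b" "x = (T ^^ j) b"
proof -
  have "x \<in> aper T" using assms Y_aper by blast
  from tower_exists[OF bij_T recurrent_B[of k] this] obtain b j
    where b: "b \<in> B k" "j < ret T (B k) b" "x = (T ^^ j) b" .
  have "b \<in> Y" using b(3) Y_inv assms by blast
  then show ?thesis using that b unfolding h_def by blast
qed

section \<open>The partitions into towers and their orders\<close>

definition tower :: "nat \<Rightarrow> 'a \<Rightarrow> 'a set" where
  "tower k b = (\<lambda>j. (T ^^ j) b) ` {..<h k b}"

definition \<xi> :: "nat \<Rightarrow> 'a set set" where
  "\<xi> k = tower k ` (B k \<inter> Y)"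

definition base :: "nat \<Rightarrow> 'a \<Rightarrow> 'a" where
  "base k x = (inv T ^^ off T (B k) x) x"

text \<open>A tower meets \<open>B k\<close> only in its base point. The steps of \<open>R k\<close>
  back from there to \<open>B (Suc k)\<close> count the towers stacked below it.\<close>

definition pos :: "nat \<Rightarrow> 'a set \<Rightarrow> nat" where
  "pos k \<alpha> = off (R k) (B (Suc k)) (THE b. b \<in> \<alpha> \<inter> B k)"

lemma off_T: "b \<in> B k \<Longrightarrow> j < h k b \<Longrightarrow> off T (B k) ((T ^^ j) b) = j"
  unfolding h_def by (rule off_tower[OF bij_T])

lemma base_T: "b \<in> B k \<Longrightarrow> j < h k b \<Longrightarrow> base k ((T ^^ j) b) = b"
  unfolding base_def off_T using funpow_inv(2)[OF bij_T] by simp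

lemma card_tower: "b \<in> B k \<Longrightarrow> card (tower k b) = h k b"
proof -
  assume "b \<in> B k"
  then have "b \<in> aper T" using B_aper by blast
  then have "inj_on (\<lambda>j. (T ^^ j) b) {..<h k b}" by (intro inj_onI aper_inj[OF bij_T])
  then show ?thesis unfolding tower_def by (simp add: card_image)
qed

lemma in_tower: "b \<in> B k \<Longrightarrow> b \<in> tower k b"
  unfolding tower_def using h_pos[of b k] by (intro image_eqI[of _ _ 0]) auto

lemma tower_Int_B:
  assumes "b \<in> B k"
  shows "tower k b \<inter> B k = {b}"
proof -
  have "x = b" if x: "x \<in> tower k b" "x \<in> B k" for x
  proof -
    obtain j where j: "j < h k b" "x = (T ^^ j) b" using x(1) by (auto simp: tower_def)
    have "j = 0" using not_before_ret[of j T "B k" b] j x(2) unfolding h_def by blast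
    then show ?thesis using j by simp
  qed
  then show ?thesis using in_tower[OF assms] assms by blast
qed

lemma cell_tower:
  assumes "b \<in> B k" "b \<in> Y" "j < h k b"
  shows "cell (\<xi> k) ((T ^^ j) b) = tower k b"
  unfolding cell_def
proof (rule the_equality)
  show "tower k b \<in> \<xi> k \<and> (T ^^ j) b \<in> tower k b"
    using assms unfolding \<xi>_def tower_def by blast
next
  fix \<alpha> assume a: "\<alpha> \<in> \<xi> k \<and> (T ^^ j) b \<in> \<alpha>"
  then obtain c where c: "c \<in> B k" "\<alpha> = tower k c" unfolding \<xi>_def by blast
  then obtain i where "i < h k c" "(T ^^ j) b = (T ^^ i) c" using a unfolding tower_def by blast
  then show "\<alpha> = tower k b" using tower_point_unique[OF assms(1) c(1) assms(3)] c(2) by blast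
qed

lemma cell_Y: "x \<in> Y \<Longrightarrow> cell (\<xi> k) x = tower k (base k x) \<and> base k x \<in> B k \<inter> Y \<and> x \<in> tower k (base k x)"
proof -
  assume "x \<in> Y"
  then obtain b j where b: "b \<in> B k" "b \<in> Y" "j < h k b" "x = (T ^^ j) b" using Y_tower_exists by blast
  have "x \<in> tower k b" using b(3,4) unfolding tower_def by blast
  then show ?thesis using cell_tower[OF b(1-3)] base_T[OF b(1,3)] b by simp
qed

lemma pos_tower:
  assumes b: "b \<in> B (Suc k)" and p: "p < r k b"
  shows "pos k (tower k ((R k ^^ p) b)) = p"
proof -
  have "(R k ^^ p) b \<in> B k" using b B_Suc_subset R_B by blast
  then show ?thesis
    unfolding pos_def tower_Int_B[OF \<open>(R k ^^ p) b \<in> B k\<close>] using off_tower[OF bij_R b p[unfolded r_def]] by simp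
qed

text \<open>The base of a level-\<open>k\<close> tower inside the larger tower lies in one of the
  stacked blocks, and being in \<open>B k\<close> it must sit at offset \<open>0\<close>
  there.\<close>

lemma quot_elem_tower:
  assumes b: "b \<in> B (Suc k)" "b \<in> Y"
  shows "quot_elem \<xi> k (tower (Suc k) b) = (\<lambda>p. tower k ((R k ^^ p) b)) ` {..<r k b}"
proof (intro equalityI subsetI)
  have bk: "b \<in> B k" using b B_Suc_subset by blast
  fix \<alpha> assume "\<alpha> \<in> quot_elem \<xi> k (tower (Suc k) b)"
  then have a: "\<alpha> \<in> \<xi> k" "\<alpha> \<subseteq> tower (Suc k) b" unfolding quot_elem_def by auto
  then obtain c where c: "c \<in> B k" "\<alpha> = tower k c" unfolding \<xi>_def by blast
  then have "c \<in> tower (Suc k) b" using in_tower a(2) by blast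
  then obtain i where i: "i < h (Suc k) b" "c = (T ^^ i) b" unfolding tower_def by blast
  obtain p j where pj: "p < r k b" "j < h k ((R k ^^ p) b)" "(T ^^ i) b = (T ^^ j) ((R k ^^ p) b)"
    using sub_tower_exists[OF b(1) i(1)] by metis
  have "(T ^^ 0) c = (T ^^ j) ((R k ^^ p) b)" using pj(3) i(2) by simp
  then have "c = (R k ^^ p) b"
    using tower_point_unique[OF c(1) R_B[OF bk] h_pos[OF c(1)] pj(2)] by blast
  then show "\<alpha> \<in> (\<lambda>p. tower k ((R k ^^ p) b)) ` {..<r k b}" using c(2) pj(1) by blast
next
  have bk: "b \<in> B k" using b B_Suc_subset by blast
  fix \<alpha> assume "\<alpha> \<in> (\<lambda>p. tower k ((R k ^^ p) b)) ` {..<r k b}"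
  then obtain p where p: "p < r k b" "\<alpha> = tower k ((R k ^^ p) b)" by blast
  have "\<alpha> \<in> \<xi> k" unfolding \<xi>_def p(2) using R_B[OF bk] R_Y[OF bk b(2)] by blast
  moreover have "\<alpha> \<subseteq> tower (Suc k) b"
  proof
    fix x assume "x \<in> \<alpha>"
    then obtain j where j: "j < h k ((R k ^^ p) b)" "x = (T ^^ j) ((R k ^^ p) b)"
      unfolding p(2) tower_def by blast
    show "x \<in> tower (Suc k) b"
      unfolding j(2) sub_tower(1)[OF b(1) p(1) j(1)] tower_def using sub_tower(2)[OF b(1) p(1) j(1)] by blast
  qed
  ultimately show "\<alpha> \<in> quot_elem \<xi> k (tower (Suc k) b)" unfolding quot_elem_def by blast
qed

lemma inj_on_sub_towers: "b \<in> B (Suc k) \<Longrightarrow> inj_on (\<lambda>p. tower k ((R k ^^ p) b)) {..<r k b}"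
  by (rule inj_on_inverseI[where g = "pos k"]) (use pos_tower in auto)

lemma card_quot_elem_tower: "b \<in> B (Suc k) \<Longrightarrow> b \<in> Y \<Longrightarrow> card (quot_elem \<xi> k (tower (Suc k) b)) = r k b"
  using quot_elem_tower inj_on_sub_towers by (simp add: card_image)

text \<open>The lexicographic rank agrees with the height: the blocks stacked below contribute their
  heights, and the induction hypothesis supplies the offset in the block itself.\<close>

lemma frank_tower:
  "b \<in> B k \<Longrightarrow> b \<in> Y \<Longrightarrow> j < h k b \<Longrightarrow> frank \<xi> pos k ((T ^^ j) b) = j"
proof (induction k arbitrary: b j)
  case 0
  then show ?case using h_0 by simp
next
  case (Suc k)
  note b = Suc.prems
  have bk: "b \<in> B k" using b B_Suc_subset by blast
  obtain p i where pi: "p < r k b" "i < h k ((R k ^^ p) b)" "j = (\<Sum>l<p. h k ((R k ^^ l) b)) + i"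
    "(T ^^ j) b = (T ^^ i) ((R k ^^ p) b)"
    using sub_tower_exists[OF b(1,3)] .
  let ?g = "\<lambda>p. tower k ((R k ^^ p) b)"
  have a: "(R k ^^ p) b \<in> B k" "(R k ^^ p) b \<in> Y" using R_B[OF bk] R_Y[OF bk b(2)] by auto
  have cell: "cell (\<xi> k) ((T ^^ j) b) = ?g p" unfolding pi(4) by (rule cell_tower[OF a pi(2)])
  have "{\<alpha> \<in> quot_elem \<xi> k (cell (\<xi> (Suc k)) ((T ^^ j) b)). pos k \<alpha> < pos k (cell (\<xi> k) ((T ^^ j) b))}
      = ?g ` {..<p}"
    unfolding cell cell_tower[OF b] quot_elem_tower[OF b(1,2)] pos_tower[OF b(1) pi(1)]
    using pos_tower[OF b(1)] pi(1) by auto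
  moreover have "(\<Sum>\<alpha>\<in>?g ` {..<p}. card \<alpha>) = (\<Sum>l<p. h k ((R k ^^ l) b))"
  proof -
    have "inj_on ?g {..<p}" by (rule inj_on_subset[OF inj_on_sub_towers[OF b(1)]]) (use pi(1) in auto)
    then show ?thesis using card_tower[OF R_B[OF bk]] by (simp add: sum.reindex)
  qed
  moreover have "frank \<xi> pos k ((T ^^ j) b) = i" unfolding pi(4) by (rule Suc.IH[OF a pi(2)])
  ultimately show ?case using pi(3) by simp
qed

section \<open>Borel measurability of the filtration\<close>

text \<open>One of countably many Borel powers is applied, selected by a Borel function with values
  in the naturals.\<close>

lemma measurable_base: "base k \<in> borel_measurable borel"
  unfolding base_def[abs_def]
  by (rule measurable_compose_countable[OF automorphism_measurable(2)[OF aut_T] measurable_off[OF aut_T B_borel]])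

text \<open>Since \<open>base\<close> is Borel, this exhibits the tower relation as a preimage of
  the diagonal inside \<open>Y \<times> Y\<close>.\<close>

lemma same_tower_iff: "(\<exists>\<alpha>\<in>\<xi> k. x \<in> \<alpha> \<and> y \<in> \<alpha>) \<longleftrightarrow> x \<in> Y \<and> y \<in> Y \<and> base k x = base k y"
proof
  assume "\<exists>\<alpha>\<in>\<xi> k. x \<in> \<alpha> \<and> y \<in> \<alpha>"
  then obtain b where b: "b \<in> B k" "b \<in> Y" "x \<in> tower k b" "y \<in> tower k b" unfolding \<xi>_def by blast
  then obtain i j where "i < h k b" "x = (T ^^ i) b" "j < h k b" "y = (T ^^ j) b" unfolding tower_def by blast
  then show "x \<in> Y \<and> y \<in> Y \<and> base k x = base k y" using b base_T Y_inv by simp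
next
  assume xy: "x \<in> Y \<and> y \<in> Y \<and> base k x = base k y"
  then have "base k x \<in> B k \<inter> Y" "x \<in> tower k (base k x)" "y \<in> tower k (base k x)"
    using cell_Y[of x k] cell_Y[of y k] by auto
  then show "\<exists>\<alpha>\<in>\<xi> k. x \<in> \<alpha> \<and> y \<in> \<alpha>" unfolding \<xi>_def by blast
qed

lemma partition_\<xi>: "partition_on Y (\<xi> k)"
proof (rule partition_onI)
  show "\<Union> (\<xi> k) = Y"
    using same_tower_iff[of k] by blast
  fix \<alpha> \<beta> assume ab: "\<alpha> \<in> \<xi> k" "\<beta> \<in> \<xi> k" "\<alpha> \<noteq> \<beta>"
  show "disjnt \<alpha> \<beta>"
  proof -
    obtain a b where c: "a \<in> B k" "b \<in> B k" "\<alpha> = tower k a" "\<beta> = tower k b" using ab unfolding \<xi>_def by blast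
    have False if x: "x \<in> \<alpha>" "x \<in> \<beta>" for x
    proof -
      obtain i j where "i < h k a" "x = (T ^^ i) a" "j < h k b" "x = (T ^^ j) b"
        using x unfolding c tower_def by blast
      then show False using tower_point_unique[OF c(1,2)] ab(3) c by metis
    qed
    then show ?thesis unfolding disjnt_def by blast
  qed
next
  have "tower k b \<noteq> {}" if "b \<in> B k" for b using in_tower[OF that] by blast
  then show "{} \<notin> \<xi> k" unfolding \<xi>_def by auto
qed

lemma borel_partition_\<xi>: "borel_partition Y (\<xi> k)"
proof -
  have "\<alpha> \<in> sets borel" if "\<alpha> \<in> \<xi> k" for \<alpha>
  proof -
    have "finite \<alpha>" using that unfolding \<xi>_def tower_def by auto
    then show ?thesis by (intro borel_closed finite_imp_closed)
  qed
  moreover have "{(x, y). \<exists>\<alpha>\<in>\<xi> k. x \<in> \<alpha> \<and> y \<in> \<alpha>} \<in> sets (borel \<Otimes>\<^sub>M borel)"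
  proof -
    have "(\<lambda>z. (base k (fst z), base k (snd z))) \<in> measurable (borel \<Otimes>\<^sub>M borel) (borel \<Otimes>\<^sub>M (borel :: 'a measure))"
      by (intro measurable_Pair measurable_compose[OF measurable_fst measurable_base]
          measurable_compose[OF measurable_snd measurable_base])
    from measurable_sets[OF this diagonal_borel[OF U]]
    have "(\<lambda>z. (base k (fst z), base k (snd z))) -` {(x, y). x = y} \<in> sets (borel \<Otimes>\<^sub>M (borel :: 'a measure))"
      by (simp add: space_pair_measure)
    moreover have "Y \<times> Y \<in> sets (borel \<Otimes>\<^sub>M borel)" using Y_borel by (intro pair_measureI)
    moreover have "{(x, y). \<exists>\<alpha>\<in>\<xi> k. x \<in> \<alpha> \<and> y \<in> \<alpha>}
        = Y \<times> Y \<inter> (\<lambda>z. (base k (fst z), base k (snd z))) -` {(x, y). x = y}"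
      unfolding same_tower_iff by auto
    ultimately show ?thesis by (simp only: sets.Int)
  qed
  ultimately show ?thesis unfolding borel_partition_def using partition_\<xi> by blast
qed

lemma \<xi>_0: "\<xi> 0 = {{x} | x. x \<in> Y}"
proof -
  have "tower 0 x = {x}" if "x \<in> B 0" for x using h_0[OF that] by (simp add: tower_def lessThan_Suc)
  moreover have "B 0 \<inter> Y = Y" using B_0 Y_aper by auto
  ultimately have "\<xi> 0 = (\<lambda>x. {x}) ` Y" unfolding \<xi>_def by (intro image_cong) auto
  then show ?thesis by blast
qed

lemma \<xi>_coarser: "\<alpha> \<in> \<xi> k \<Longrightarrow> \<exists>\<beta>\<in>\<xi> (Suc k). \<alpha> \<subseteq> \<beta>"
proof -
  assume a: "\<alpha> \<in> \<xi> k"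
  then obtain x where x: "x \<in> B k" "x \<in> Y" "\<alpha> = tower k x" unfolding \<xi>_def by blast
  obtain b i where b: "b \<in> B (Suc k)" "b \<in> Y" "i < h (Suc k) b" "x = (T ^^ i) b"
    using Y_tower_exists[OF x(2)] .
  have bk: "b \<in> B k" using b(1) B_Suc_subset by blast
  obtain p j where pj: "p < r k b" "j < h k ((R k ^^ p) b)" "(T ^^ i) b = (T ^^ j) ((R k ^^ p) b)"
    using sub_tower_exists[OF b(1,3)] by metis
  have "(T ^^ 0) x = (T ^^ j) ((R k ^^ p) b)" using pj(3) b(4) by simp
  then have "x = (R k ^^ p) b" using tower_point_unique[OF x(1) R_B[OF bk] h_pos[OF x(1)] pj(2)] by blast
  then have "\<alpha> \<in> quot_elem \<xi> k (tower (Suc k) b)" using quot_elem_tower[OF b(1,2)] pj(1) x(3) by blast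
  then have "\<alpha> \<subseteq> tower (Suc k) b" unfolding quot_elem_def by blast
  then show ?thesis using b(1,2) unfolding \<xi>_def by blast
qed

lemma ordered_filtration_\<xi>: "ordered_filtration Y \<xi> pos"
proof -
  have "bij_betw (pos n) (quot_elem \<xi> n \<beta>) {..<card (quot_elem \<xi> n \<beta>)}" if \<beta>: "\<beta> \<in> \<xi> (Suc n)" for n \<beta>
  proof -
    obtain b where b: "b \<in> B (Suc n)" "b \<in> Y" "\<beta> = tower (Suc n) b" using \<beta> unfolding \<xi>_def by blast
    have "bij_betw (pos n) ((\<lambda>p. tower n ((R n ^^ p) b)) ` {..<r n b}) {..<r n b}"
      by (rule bij_betw_byWitness[where f' = "\<lambda>p. tower n ((R n ^^ p) b)"])
        (use pos_tower[OF b(1)] in auto)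
    then show ?thesis unfolding b(3) card_quot_elem_tower[OF b(1,2)] unfolding quot_elem_tower[OF b(1,2)] .
  qed
  moreover have "{x \<in> Y. pos n (cell (\<xi> n) x) = i} \<in> sets borel" for n i
  proof -
    \<comment> \<open>The position depends on the point only through its base, which makes it a
      composition of Borel maps.\<close>
    have eq: "pos n (cell (\<xi> n) x) = off (R n) (B (Suc n)) (base n x)" if x: "x \<in> Y" for x
    proof -
      have "cell (\<xi> n) x = tower n (base n x)" "base n x \<in> B n" using cell_Y[OF x] by auto
      then show ?thesis unfolding pos_def by (simp add: tower_Int_B)
    qed
    have "(\<lambda>x. off (R n) (B (Suc n)) (base n x)) \<in> measurable borel (count_space UNIV)"
      by (rule measurable_compose[OF measurable_base measurable_off[OF aut B_borel]])
    then have "(\<lambda>x. off (R n) (B (Suc n)) (base n x)) -` {i} \<in> sets borel"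
      by (rule measurable_sets_borel) simp
    moreover have "{x \<in> Y. pos n (cell (\<xi> n) x) = i} = Y \<inter> (\<lambda>x. off (R n) (B (Suc n)) (base n x)) -` {i}"
      using eq by auto
    ultimately show ?thesis using Y_borel by simp
  qed
  moreover have "borel_filtration Y \<xi>"
    unfolding borel_filtration_def using borel_partition_\<xi> \<xi>_0 \<xi>_coarser by blast
  ultimately show ?thesis unfolding ordered_filtration_def by blast
qed

lemma locally_finite_\<xi>: "locally_finite_filtration \<xi>"
  unfolding locally_finite_filtration_def
proof
  fix n
  obtain H where H: "\<And>x. x \<in> B n \<Longrightarrow> h n x \<le> H" using h_bounded[of n] by blast
  have "finite \<alpha> \<and> card \<alpha> \<le> H" if a: "\<alpha> \<in> \<xi> n" for \<alpha>
  proof -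
    obtain b where b: "b \<in> B n" "\<alpha> = tower n b" using a unfolding \<xi>_def by blast
    then have "finite \<alpha>" by (simp add: tower_def)
    then show ?thesis using card_tower[OF b(1)] H[OF b(1)] b(2) by simp
  qed
  then show "\<exists>C. \<forall>\<alpha>\<in>\<xi> n. finite \<alpha> \<and> card \<alpha> \<le> C" by blast
qed

section \<open>Exhaustion of orbits by towers\<close>

text \<open>Each point of \<open>Y\<close> leaves the decreasing sets \<open>B k\<close>, so for
  large \<open>k\<close> the finite orbit segment from \<open>x\<close> to \<open>(T ^^ n) x\<close>
  avoids \<open>B k\<close>. It then cannot cross the top of a tower, since the orbit enters
  \<open>B k\<close> there.\<close>

lemma common_tower:
  assumes "x \<in> Y"
  shows "\<exists>k b. b \<in> B k \<inter> Y \<and> x \<in> tower k b \<and> (T ^^ n) x \<in> tower k b"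
proof -
  have "\<exists>k. (T ^^ i) x \<notin> B k" for i using Y_vanish[of "(T ^^ i) x"] Y_inv assms by (auto simp: B_def)
  then obtain K where K: "\<And>i. (T ^^ i) x \<notin> B (K i)" by metis
  define k where "k = Max (K ` {..n})"
  have away: "(T ^^ i) x \<notin> B k" if "i \<le> n" for i
  proof -
    have "K i \<le> k" unfolding k_def using that by (intro Max_ge) auto
    then show ?thesis using K B_antimono by blast
  qed
  obtain b j where b: "b \<in> B k" "b \<in> Y" "j < h k b" "x = (T ^^ j) b" using Y_tower_exists[OF assms] .
  have "n + j < h k b"
  proof (rule ccontr)
    assume "\<not> n + j < h k b"
    then have le: "h k b - j \<le> n" by simp
    \<comment> \<open>Leaving the tower within \<open>n\<close> steps would lead through
      \<open>R k b\<close>, a point of \<open>B k\<close>.\<close>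
    have "(T ^^ (h k b - j)) x = (T ^^ (h k b - j + j)) b" unfolding funpow_plus b(4) ..
    also have "\<dots> = R k b" using b(1,3) tower_level[of k] by (simp add: tower_level_def)
    also have "\<dots> \<in> B k" using R_B[OF b(1), of 1] by simp
    finally show False using away[OF le] by blast
  qed
  moreover have "(T ^^ n) x = (T ^^ (n + j)) b" unfolding funpow_plus b(4) ..
  ultimately have "(T ^^ n) x \<in> tower k b" unfolding tower_def by blast
  moreover have "x \<in> tower k b" unfolding tower_def using b(3,4) by blast
  ultimately show ?thesis using b(1,2) by blast
qed

lemma cell_of_tower: "b \<in> B k \<inter> Y \<Longrightarrow> x \<in> tower k b \<Longrightarrow> cell (\<xi> k) x = tower k b"
  using cell_tower unfolding tower_def by blast

text \<open>Towers are orbit segments, which gives one inclusion. For the other,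
  \<open>common_tower\<close> is applied to whichever of the two points comes first along the
  orbit.\<close>

lemma Union_cells:
  assumes x: "x \<in> Y"
  shows "(\<Union>k. cell (\<xi> k) x) = orbit T x"
proof (intro equalityI subsetI)
  fix y assume "y \<in> (\<Union>k. cell (\<xi> k) x)"
  then obtain k where k: "y \<in> tower k (base k x)" "x \<in> tower k (base k x)" using cell_Y[OF x] by auto
  then obtain i j where ij: "y = (T ^^ i) (base k x)" "x = (T ^^ j) (base k x)" unfolding tower_def by blast
  show "y \<in> orbit T x"
  proof (cases "i \<le> j")
    case True
    then have "x = (T ^^ (j - i)) y" using ij funpow_plus[of "j - i" i T "base k x"] by simp
    then show ?thesis unfolding orbit_def by blast
  next
    case False
    then have "y = (T ^^ (i - j)) x" using ij funpow_plus[of "i - j" j T "base k x"] by simp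
    then show ?thesis unfolding orbit_def by blast
  qed
next
  fix y assume "y \<in> orbit T x"
  then obtain n where "y = (T ^^ n) x \<or> x = (T ^^ n) y" unfolding orbit_def by blast
  then have "\<exists>k b. b \<in> B k \<inter> Y \<and> x \<in> tower k b \<and> y \<in> tower k b"
  proof
    assume "y = (T ^^ n) x"
    then show ?thesis using common_tower[OF x, of n] by blast
  next
    assume xy: "x = (T ^^ n) y"
    then have "y \<in> Y" using x Y_inv by blast
    from common_tower[OF this, of n] show ?thesis unfolding xy by blast
  qed
  then obtain k b where kb: "b \<in> B k \<inter> Y" "x \<in> tower k b" "y \<in> tower k b" by blast
  then show "y \<in> (\<Union>k. cell (\<xi> k) x)" using cell_of_tower[OF kb(1,2)] by blast
qed

lemma basic_filtration_for_\<xi>: "basic_filtration_for T Y \<xi> pos"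
proof -
  have "\<exists>x. \<alpha> = {(T ^^ j) x | j. j < card \<alpha>} \<and> (\<forall>j<card \<alpha>. frank \<xi> pos k ((T ^^ j) x) = j)"
    if a: "\<alpha> \<in> \<xi> k" for k \<alpha>
  proof -
    obtain b where b: "b \<in> B k" "b \<in> Y" "\<alpha> = tower k b" using a unfolding \<xi>_def by blast
    have c: "card \<alpha> = h k b" using card_tower b by simp
    have "tower k b = {(T ^^ j) b | j. j < h k b}" unfolding tower_def by blast
    then have "\<alpha> = {(T ^^ j) b | j. j < card \<alpha>}" using b(3) unfolding c by (rule trans[rotated])
    moreover have "\<forall>j<card \<alpha>. frank \<xi> pos k ((T ^^ j) b) = j"
      unfolding c using frank_tower[OF b(1,2)] by (intro allI impI)
    ultimately show ?thesis by (intro exI[of _ b] conjI)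
  qed
  then show ?thesis
    unfolding basic_filtration_for_def basic_filtration_def
    by (intro conjI ordered_filtration_\<xi> locally_finite_\<xi> allI ballI Union_cells)
qed

lemma subordinate_\<xi>: "subordinate (quot_partition \<xi> k) (s (Suc k))"
proof -
  have "finite Q \<and> card Q \<in> s (Suc k)" if Q: "Q \<in> quot_partition \<xi> k" for Q
  proof -
    obtain \<beta> where \<beta>: "\<beta> \<in> \<xi> (Suc k)" "Q = quot_elem \<xi> k \<beta>"
      using Q unfolding quot_partition_def by blast
    then obtain b where b: "b \<in> B (Suc k)" "b \<in> Y" "Q = quot_elem \<xi> k (tower (Suc k) b)"
      unfolding \<xi>_def[of "Suc k"] by blast
    have "finite Q" unfolding b(3) quot_elem_tower[OF b(1,2)] by simp
    then show ?thesis using card_quot_elem_tower[OF b(1,2)] b(3) r_props(3)[OF b(1)] by simp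
  qed
  then show ?thesis unfolding subordinate_def by blast
qed

end

section \<open>The universal invariant set and its filtration\<close>

theorem theorem2:
  fixes T :: "'a::metric_space \<Rightarrow> 'a" and s :: "nat \<Rightarrow> nat set"
  assumes separable: "\<exists>D::'a set. countable D \<and> closure D = UNIV"
    and sigs: "\<And>k. k \<ge> 1 \<Longrightarrow> signature (s k) \<and> primitive_sig (s k) \<and> \<not> trivial_sig (s k)"
    and T: "borel_automorphism T"
  shows "\<exists>Xh \<xi> pos. metrically_universal T Xh \<and> T ` Xh = Xh
           \<and> (\<forall>x\<in>Xh. \<not> periodic_pt T x)
           \<and> basic_filtration_for T Xh \<xi> pos
           \<and> (\<forall>k\<ge>1. subordinate (quot_partition \<xi> (k - 1)) (s k))"
proof -
  note bij = borel_automorphism_bij[OF T]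
  obtain U :: "nat \<Rightarrow> 'a set" where U: "countable_basis U"
    using separable countable_basis_exists by blast
  have s: "signature (s (Suc k)) \<and> primitive_sig (s (Suc k)) \<and> \<not> trivial_sig (s (Suc k))" for k
    using sigs[of "Suc k"] by simp
  obtain R where R0: "R 0 = T" and R: "\<And>k. borel_automorphism (R k)"
    "\<And>k. recurrent_section (R k) (aper (R (Suc k)))" "\<And>k. R (Suc k) = induced (R k) (aper (R (Suc k)))"
    "\<And>k x. x \<in> aper (R (Suc k)) \<Longrightarrow> ret (R k) (aper (R (Suc k))) x \<in> s (Suc k)"
    and inv: "\<And>k \<mu>. invariant_prob (R k) \<mu> \<Longrightarrow> invariant_prob (R (Suc k)) \<mu>"
    and half: "\<And>k \<mu>. invariant_prob (R k) \<mu> \<Longrightarrow> 2 * measure \<mu> (aper (R (Suc k))) \<le> measure \<mu> (aper (R k)) + (1 / 2) ^ k"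
    by (rule induced_sequence_exists[OF U T, of s, OF s]) (rule that; assumption)
  define Z where "Z = (\<Inter>k. aper (R k))"
  \<comment> \<open>Removing \<open>Z\<close> alone need not leave an invariant set. Its whole
    orbits are removed instead, which are still null for every invariant measure.\<close>
  define Y where "Y = aper T - (\<Union>n. (T ^^ n) -` Z \<union> (inv T ^^ n) -` Z)"
  have B: "aper (R k) \<in> sets borel" for k by (rule aper_borel[OF U R(1)])
  have Z: "Z \<in> sets borel" unfolding Z_def using B by (intro sets.countable_INT image_subsetI UNIV_not_empty)
  have Yb: "Y \<in> sets borel" unfolding Y_def
    using aper_borel[OF U T] funpow_vimage_borel[OF T Z] by (intro sets.Diff sets.countable_UN image_subsetI sets.Un)
  have Y_T: "T x \<in> Y \<longleftrightarrow> x \<in> Y" for x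
  proof -
    \<comment> \<open>Passing from \<open>x\<close> to \<open>T x\<close> shifts the two-sided orbit
      by one index; the two one-sided enumerations meet at index \<open>0\<close>, which needs
      separate treatment.\<close>
    have "(\<exists>n. (T ^^ n) (T x) \<in> Z \<or> (inv T ^^ n) (T x) \<in> Z) \<longleftrightarrow> (\<exists>n. (T ^^ n) x \<in> Z \<or> (inv T ^^ n) x \<in> Z)"
    proof -
      have 1: "(T ^^ n) (T x) = (T ^^ Suc n) x" "(inv T ^^ Suc n) (T x) = (inv T ^^ n) x" for n
        by (simp_all only: funpow_Suc_right comp_def inv_f_f[OF bij_is_inj[OF bij]])
      have 2: "(T ^^ 0) x = x" "(inv T ^^ 0) x = x" "(inv T ^^ 0) (T x) = (T ^^ Suc 0) x" by simp_all
      show ?thesis by (metis 1 2 not0_implies_Suc)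
    qed
    then show ?thesis unfolding Y_def using aper_funpow[OF bij, of 1 x] by auto
  qed
  have Y_inv: "(T ^^ n) x \<in> Y \<longleftrightarrow> x \<in> Y" for n x
    by (induction n) (simp_all add: Y_T)
  have vanish: "\<exists>k. x \<notin> aper (R k)" if "x \<in> Y" for x
  proof -
    \<comment> \<open>Index \<open>0\<close> of the removed union is \<open>Z\<close>
      itself.\<close>
    have "(T ^^ 0) x \<notin> Z" using that unfolding Y_def by blast
    then show ?thesis unfolding Z_def by simp
  qed
  interpret induced_tower T R s U Y
  proof
    show "finite (s (Suc k))" for k using s by (simp add: signature_def)
    show "Y \<subseteq> aper T" unfolding Y_def by (rule Diff_subset)
  qed (fact U R0 R Yb Y_inv vanish)+
  have "metrically_universal T Y"
    unfolding metrically_universal_def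
  proof (intro conjI ballI Yb)
    fix \<mu> assume "\<mu> \<in> M_ap T"
    then have \<mu>: "invariant_prob T \<mu>" and AE: "AE x in \<mu>. x \<in> aper T"
      unfolding M_ap_def invariant_prob_def aper_def mem_Collect_eq by blast+
    have "aper (R (Suc k)) \<subseteq> aper (R k)" for k using R(2)[of k] unfolding recurrent_section_def by blast
    then have "emeasure \<mu> Z = 0"
      unfolding Z_def using \<mu> unfolding R0[symmetric] by (intro aper_inter_null B inv half)
    then show "emeasure \<mu> Y = 1"
      unfolding Y_def by (rule aper_diff_orbits_full[OF \<mu> T aper_borel[OF U T] AE Z])
  qed
  moreover have "T ` Y = Y"
  proof (intro equalityI subsetI)
    fix y assume "y \<in> Y"
    moreover have "y = T (inv T y)" using bij by (simp add: bij_is_surj surj_f_inv_f)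
    ultimately show "y \<in> T ` Y" using Y_T by (metis imageI)
  qed (use Y_T in auto)
  moreover have "\<not> periodic_pt T x" if "x \<in> Y" for x
    using that Y_aper by (auto simp: aper_def)
  moreover have "subordinate (quot_partition \<xi> (k - 1)) (s k)" if "k \<ge> 1" for k
    using subordinate_\<xi>[of "k - 1"] that by simp
  ultimately show ?thesis using basic_filtration_for_\<xi> by blast
qed

end
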